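(* Let $H$ be a complex Hilbert space and let $\mathcal T=(T_1,\dots,T_n)\in B(H)^n$ be an $n$-tuple of bounded linear operators (not assumed to commute). Then $$\operatorname{Int}\,\operatorname{conv}\bigl(W_e(\mathcal T)\cup\sigma_p(\mathcal T)\bigr)\subset W(\mathcal T).$$ Moreover, if the tuple $\mathcal T$ is commuting (i.e. $T_iT_j=T_jT_i$ for all $i,j$), then $$\operatorname{Int}\,\operatorname{conv}\,\sigma(\mathcal T)\subset W(\mathcal T).$$
   Context: $B(H)$ is the algebra of bounded linear operators on $H$. $\operatorname{Int}$ denotes interior in $\mathbb C^n$ and $\operatorname{conv}$ the convex hull. Joint numerical range: $W(\mathcal T)=\{(\langle T_1x,x\rangle,\dots,\langle T_nx,x\rangle): x\in H,\ \|x\|=1\}\subset\mathbb C^n$. Joint essential numerical range: $W_e(\mathcal T)$ is the set of all $(\lambda_1,\dots,\lambda_n)\in\mathbb C^n$ for which there exists an orthonormal sequence $(x_k)_{k\ge1}\subset H$ with $\lim_{k\to\infty}\langle T_jx_k,x_k\rangle=\lambda_j$ for $j=1,\dots,n$. Joint point spectrum: $\sigma_p(\mathcal T)$ is the set of all $(\lambda_1,\dots,\lambda_n)\in\mathbb C^n$ such that $\bigcap_{j=1}^n N(T_j-\lambda_j)\neq\{0\}$, where $N(\cdot)$ denotes the kernel. Joint (Harte) spectrum of a commuting tuple: $\sigma(\mathcal T)$ is the complement in $\mathbb C^n$ of the set of those $(\lambda_1,\dots,\lambda_n)$ for which there exist $L_j,R_j\in B(H)$, $1\le j\le n$, with $\sum_{j=1}^nL_j(T_j-\lambda_j)=\sum_{j=1}^n(T_j-\lambda_j)R_j=I$.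 *)

theory Defs
  imports "HOL-Analysis.Analysis"
begin

text \<open>
  The scalar product of the distribution's class of inner product spaces is real.  A complex
  inner product space is presented over it: \<open>inner\<close> is the real part of the complex inner
  product \<open>cinner\<close>, so norm, metric and topology are those of \<open>cinner\<close>, and positive
  definiteness of \<open>cinner\<close> is inherited from \<open>inner\<close> (lemma \<open>cinner_self\<close>).
  \<open>cinner\<close> is linear in its first argument.
\<close>

class complex_inner = real_inner +
  fixes scaleC :: "complex \<Rightarrow> 'a \<Rightarrow> 'a" (infixr "*\<^sub>C" 75)
    and cinner :: "'a \<Rightarrow> 'a \<Rightarrow> complex"
  assumes scaleC_add_right: "a *\<^sub>C (x + y) = a *\<^sub>C x + a *\<^sub>C y"
    and scaleC_add_left: "(a + b) *\<^sub>C x = a *\<^sub>C x + b *\<^sub>C x"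
    and scaleC_scaleC: "a *\<^sub>C b *\<^sub>C x = (a * b) *\<^sub>C x"
    and scaleC_of_real: "complex_of_real r *\<^sub>C x = scaleR r x"
    and cinner_commute: "cinner x y = cnj (cinner y x)"
    and cinner_add_left: "cinner (x + y) z = cinner x z + cinner y z"
    and cinner_scaleC_left: "cinner (a *\<^sub>C x) y = a * cinner x y"
    and Re_cinner: "Re (cinner x y) = inner x y"

class complex_hilbert_space = complex_inner + complete_space

subclass (in complex_hilbert_space) banach ..

lemma cinner_self: "cinner x x = complex_of_real ((norm x)\<^sup>2)"
  for x :: "'a::complex_inner"
proof (rule complex_eqI)
  show "Re (cinner x x) = Re (complex_of_real ((norm x)\<^sup>2))"
    by (simp add: Re_cinner power2_norm_eq_inner)
  have "Im (cinner x x) = Im (cnj (cinner x x))"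
    using cinner_commute[of x x] by (rule arg_cong)
  then show "Im (cinner x x) = Im (complex_of_real ((norm x)\<^sup>2))"
    by simp
qed

text \<open>Membership in \<open>B(H)\<close>; \<open>bounded_linear\<close> only gives real linearity.\<close>

definition bounded_clinear :: "('a::complex_inner \<Rightarrow> 'a) \<Rightarrow> bool" where
  "bounded_clinear T \<longleftrightarrow> bounded_linear T \<and> (\<forall>a x. T (a *\<^sub>C x) = a *\<^sub>C T x)"

definition orthonormal_seq :: "(nat \<Rightarrow> 'a::complex_inner) \<Rightarrow> bool" where
  "orthonormal_seq x \<longleftrightarrow> (\<forall>k l. cinner (x k) (x l) = (if k = l then 1 else 0))"

definition joint_numerical_range ::
    "('n::finite \<Rightarrow> 'a::complex_inner \<Rightarrow> 'a) \<Rightarrow> (complex ^ 'n) set" where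
  "joint_numerical_range T = {(\<chi> j. cinner (T j x) x) | x. norm x = 1}"

definition joint_essential_numerical_range ::
    "('n::finite \<Rightarrow> 'a::complex_inner \<Rightarrow> 'a) \<Rightarrow> (complex ^ 'n) set" where
  "joint_essential_numerical_range T =
     {\<mu>. \<exists>x. orthonormal_seq x \<and> (\<forall>j. (\<lambda>k. cinner (T j (x k)) (x k)) \<longlonglongrightarrow> \<mu> $ j)}"

definition joint_point_spectrum ::
    "('n::finite \<Rightarrow> 'a::complex_inner \<Rightarrow> 'a) \<Rightarrow> (complex ^ 'n) set" where
  "joint_point_spectrum T = {\<mu>. (\<Inter>j. {x. T j x - \<mu> $ j *\<^sub>C x = 0}) \<noteq> {0}}"

definition harte_spectrum ::
    "('n::finite \<Rightarrow> 'a::complex_inner \<Rightarrow> 'a) \<Rightarrow> (complex ^ 'n) set" where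
  "harte_spectrum T = - {\<mu>. \<exists>L R.
     (\<forall>j. bounded_clinear (L j) \<and> bounded_clinear (R j)) \<and>
     (\<forall>x. (\<Sum>j\<in>UNIV. L j (T j x - \<mu> $ j *\<^sub>C x)) = x) \<and>
     (\<forall>x. (\<Sum>j\<in>UNIV. T j (R j x) - \<mu> $ j *\<^sub>C R j x) = x)}"

definition commuting_tuple :: "('n \<Rightarrow> 'a \<Rightarrow> 'a) \<Rightarrow> bool" where
  "commuting_tuple T \<longleftrightarrow> (\<forall>i j. T i \<circ> T j = T j \<circ> T i)"

end

theory Submission
  imports Defs "HOL-Computational_Algebra.Fundamental_Theorem_Algebra"
begin

text \<open>
  The first inclusion rests on two ways of reaching convex combinations.

  Joint eigenvalues: let \<open>\<mu>\<close> range over finitely many of them, with joint eigenvectors \<open>v \<mu>\<close>.  For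
  \<open>x = (\<Sum>\<mu>. c \<mu> *\<^sub>C v \<mu>)\<close> the value of the tuple at \<open>x\<close> is \<open>(\<Sum>\<mu>. (c \<mu> * cinner (v \<mu>) x) * \<mu>)\<close>.  The
  numbers \<open>c \<mu> * cinner (v \<mu>) x\<close> can be given any positive values of sum \<open>1\<close>, by solving an
  extremal problem (\<open>gram_scaling\<close>).  Hence every convex combination of joint eigenvalues is a value
  at a unit vector in the span of the \<open>v \<mu>\<close>.

  Essential numerical values: such a \<open>p\<close> is approximated by values \<open>p'\<close> at unit vectors \<open>u\<close> that
  satisfy finitely many linear conditions exactly (\<open>essential_value_in_kernel\<close>).  If the conditions
  express that \<open>u\<close> and its images under the tuple are orthogonal to the vectors used so far and
  to their images, then values at \<open>sqrt s *\<^sub>R u + sqrt r *\<^sub>R y\<close> with \<open>s + r = 1\<close> are exact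
  convex combinations (\<open>realized_insert\<close>).  So all convex combinations of given joint eigenvalues
  and of slightly displaced essential values are values at unit vectors.  A point in the interior
  of a convex hull is in the hull of finitely many points and remains in it when they are
  slightly displaced (\<open>interior_convex_hull_stable\<close>).

  For the second inclusion it suffices that the Harte spectrum of a commuting tuple lies in the
  closed convex hull of the essential numerical range and the joint point spectrum, because a
  convex set and its closure have the same interior.  By separation this is a statement about each
  linear form \<open>(\<Sum>j. a j * \<nu> $ j)\<close>: its real part at a point of the spectrum is at most the real part
  at some point of the two sets (\<open>harte_spectrum_support\<close>).  The single operator
  \<open>S = (\<Sum>j. a j *\<^sub>C T j)\<close> fails to be bounded below after subtraction of some \<open>m\<close> to the right of
  the number \<open>(\<Sum>j. a j * \<nu> $ j)\<close>, and \<open>m\<close> is the value of the linear form at an essential numerical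
  value or, by commutativity, at a joint eigenvalue.
\<close>

section \<open>Complex inner product spaces\<close>

lemma norm_scaleC: "norm (a *\<^sub>C x) = cmod a * norm (x::'a::complex_inner)"
proof -
  have "cinner (a *\<^sub>C x) (a *\<^sub>C x) = a * cnj a * cinner x x"
    by (metis cinner_commute cinner_scaleC_left complex_cnj_mult mult.assoc)
  then have "complex_of_real ((norm (a *\<^sub>C x))\<^sup>2) = complex_of_real ((cmod a * norm x)\<^sup>2)"
    by (simp add: cinner_self complex_norm_square[symmetric] power_mult_distrib)
  then have "(norm (a *\<^sub>C x))\<^sup>2 = (cmod a * norm x)\<^sup>2"
    by (rule of_real_eq_iff[THEN iffD1])
  then show ?thesis by (simp add: power2_eq_iff_nonneg)
qed

lemma cinner_add_right: "cinner x (y + z) = cinner x y + cinner x (z::'a::complex_inner)"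
  by (metis cinner_commute cinner_add_left complex_cnj_add)

lemma cinner_scaleC_right: "cinner x (a *\<^sub>C y) = cnj a * cinner x (y::'a::complex_inner)"
  by (metis cinner_commute cinner_scaleC_left complex_cnj_mult)

lemma scaleR_scaleC: "r *\<^sub>R x = complex_of_real r *\<^sub>C (x::'a::complex_inner)"
  by (simp add: scaleC_of_real)

lemma cmod_cinner_le: "cmod (cinner x y) \<le> norm x * norm (y::'a::complex_inner)"
proof (cases "cinner x y = 0")
  case False
  define a where "a = cnj (cinner x y) / cmod (cinner x y)"
  have a: "cmod a = 1" using False by (simp add: a_def norm_divide)
  have "cinner (a *\<^sub>C x) y = cmod (cinner x y)"
    using False by (simp add: a_def cinner_scaleC_left complex_norm_square[symmetric] power2_eq_square
      mult.commute[of "cnj _"])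
  then have "cmod (cinner x y) = inner (a *\<^sub>C x) y"
    by (metis Re_cinner Re_complex_of_real)
  also have "\<dots> \<le> norm (a *\<^sub>C x) * norm y" by (rule norm_cauchy_schwarz)
  finally show ?thesis using a by (simp add: norm_scaleC)
qed simp

lemma bounded_bilinear_cinner: "bounded_bilinear (cinner :: 'a::complex_inner \<Rightarrow> 'a \<Rightarrow> complex)"
proof
  show "\<exists>K. \<forall>a b::'a. norm (cinner a b) \<le> norm a * norm b * K"
    using cmod_cinner_le by (intro exI[of _ 1]) auto
qed (auto simp: cinner_add_left cinner_add_right scaleR_scaleC cinner_scaleC_left
      cinner_scaleC_right scaleR_conv_of_real)

lemma bounded_bilinear_scaleC:
  "bounded_bilinear (scaleC :: complex \<Rightarrow> 'a::complex_inner \<Rightarrow> 'a)"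
proof
  show "\<exists>K. \<forall>a (b::'a). norm (a *\<^sub>C b) \<le> norm a * norm b * K"
    by (intro exI[of _ 1]) (auto simp: norm_scaleC)
qed (auto simp: scaleC_add_left scaleC_add_right scaleR_scaleC scaleC_scaleC
      scaleR_conv_of_real mult.commute)

interpretation cinner: bounded_bilinear "cinner :: 'a::complex_inner \<Rightarrow> 'a \<Rightarrow> complex"
  by (rule bounded_bilinear_cinner)

interpretation scaleC: bounded_bilinear "scaleC :: complex \<Rightarrow> 'a::complex_inner \<Rightarrow> 'a"
  by (rule bounded_bilinear_scaleC)

lemma scaleC_one [simp]: "1 *\<^sub>C x = (x::'a::complex_inner)"
  using scaleC_of_real[of 1 x] by simp

lemma scaleC_eq_0_iff [simp]: "a *\<^sub>C x = 0 \<longleftrightarrow> a = 0 \<or> (x::'a::complex_inner) = 0"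
  using norm_scaleC[of a x] by (metis mult_eq_0_iff norm_eq_zero)

lemma scaleC_sum_comp: "a *\<^sub>C (\<Sum>i\<in>I. f i *\<^sub>C v i) = (\<Sum>i\<in>I. (a * f i) *\<^sub>C (v i::'a::complex_inner))"
  by (simp add: scaleC.sum_right scaleC_scaleC)

lemma norm_add_orthogonal:
  assumes "cinner x (y::'a::complex_inner) = 0"
  shows "(norm (x + y))\<^sup>2 = (norm x)\<^sup>2 + (norm y)\<^sup>2"
proof -
  have "inner x y = 0" using assms Re_cinner[of x y] by simp
  then show ?thesis by (simp add: power2_norm_eq_inner inner_add_left inner_add_right inner_commute)
qed

lemma bounded_clinearD:
  assumes "bounded_clinear T"
  shows "bounded_linear T" "T (a *\<^sub>C x) = a *\<^sub>C T x"
  using assms by (auto simp: bounded_clinear_def)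

lemma bounded_clinear_lincomb:
  assumes "bounded_clinear T"
  shows "T (\<Sum>i\<in>I. f i *\<^sub>C v i) = (\<Sum>i\<in>I. f i *\<^sub>C T (v i))"
  using bounded_clinearD[OF assms]
  by (simp add: linear_sum bounded_linear.linear)

lemma bounded_clinear_scaleC: "bounded_clinear (\<lambda>x. a *\<^sub>C x)"
  by (auto simp: bounded_clinear_def scaleC.bounded_linear_right scaleC_scaleC mult.commute)

lemma bounded_clinear_compose:
  "bounded_clinear f \<Longrightarrow> bounded_clinear g \<Longrightarrow> bounded_clinear (\<lambda>x. f (g x))"
  by (auto simp: bounded_clinear_def intro: bounded_linear_compose)

lemma bounded_clinear_diff:
  "bounded_clinear f \<Longrightarrow> bounded_clinear g \<Longrightarrow> bounded_clinear (\<lambda>x. f x - g x)"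
  by (auto simp: bounded_clinear_def scaleC.diff_right intro: bounded_linear_sub)

lemma bounded_clinear_sum:
  "(\<And>i. i \<in> I \<Longrightarrow> bounded_clinear (f i)) \<Longrightarrow> bounded_clinear (\<lambda>x. \<Sum>i\<in>I. f i x)"
  by (auto simp: bounded_clinear_def scaleC.sum_right intro: bounded_linear_sum)

section \<open>Convex combinations of joint eigenvalues\<close>

text \<open>
  The usual argument for one operator, applied coordinatewise: apply \<open>T\<^sub>j - \<nu>\<^sub>j\<close> to a vanishing
  combination; this kills the term of \<open>\<nu>\<close> and multiplies the coefficient of \<open>\<mu>\<close> by
  \<open>\<mu>\<^sub>j - \<nu>\<^sub>j\<close>, and distinct tuples differ in some coordinate \<open>j\<close>.
\<close>

lemma joint_eigenvectors_independent:
  fixes T :: "'n::finite \<Rightarrow> 'a::complex_inner \<Rightarrow> 'a" and v :: "complex ^ 'n \<Rightarrow> 'a"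
  assumes T: "\<And>j. bounded_clinear (T j)" and "finite I"
    and v: "\<And>\<mu> j. \<mu> \<in> I \<Longrightarrow> T j (v \<mu>) = \<mu> $ j *\<^sub>C v \<mu>" "\<And>\<mu>. \<mu> \<in> I \<Longrightarrow> v \<mu> \<noteq> 0"
    and 0: "(\<Sum>\<mu>\<in>I. c \<mu> *\<^sub>C v \<mu>) = 0"
  shows "\<forall>\<mu>\<in>I. c \<mu> = 0"
  using \<open>finite I\<close> v 0
proof (induction I arbitrary: c)
  case (insert \<nu> I)
  have s: "c \<nu> *\<^sub>C v \<nu> + (\<Sum>\<mu>\<in>I. c \<mu> *\<^sub>C v \<mu>) = 0" using insert by simp
  have "c \<mu> * (\<mu> $ j - \<nu> $ j) = 0" if "\<mu> \<in> I" for \<mu> j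
  proof -
    have "0 = T j (\<Sum>\<mu>\<in>insert \<nu> I. c \<mu> *\<^sub>C v \<mu>) - \<nu> $ j *\<^sub>C (\<Sum>\<mu>\<in>insert \<nu> I. c \<mu> *\<^sub>C v \<mu>)"
      using insert.prems(3) bounded_clinearD[OF T[of j]] by (simp add: linear_simps)
    also have "\<dots> = (\<Sum>\<mu>\<in>insert \<nu> I. c \<mu> *\<^sub>C T j (v \<mu>)) - (\<Sum>\<mu>\<in>insert \<nu> I. (\<nu> $ j * c \<mu>) *\<^sub>C v \<mu>)"
      by (simp only: bounded_clinear_lincomb[OF T] scaleC_sum_comp)
    also have "\<dots> = (\<Sum>\<mu>\<in>insert \<nu> I. (c \<mu> * (\<mu> $ j - \<nu> $ j)) *\<^sub>C v \<mu>)"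
      unfolding sum_subtractf[symmetric] using insert.prems(1)
      by (intro sum.cong) (auto simp: scaleC_scaleC right_diff_distrib scaleC.diff_left mult.commute)
    also have "\<dots> = (\<Sum>\<mu>\<in>I. (c \<mu> * (\<mu> $ j - \<nu> $ j)) *\<^sub>C v \<mu>)" using insert.hyps by simp
    finally have "(\<Sum>\<mu>\<in>I. (c \<mu> * (\<mu> $ j - \<nu> $ j)) *\<^sub>C v \<mu>) = 0" by simp
    from insert.IH[OF _ _ this] insert.prems that show ?thesis by auto
  qed
  then have c0: "c \<mu> = 0" if "\<mu> \<in> I" for \<mu>
    using that insert.hyps(2) by (metis eq_iff_diff_eq_0 mult_eq_0_iff vec_eq_iff)
  then have "c \<nu> *\<^sub>C v \<nu> = 0" using s by (simp add: scaleC.zero_left)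
  then show ?case using c0 insert.prems(2) by auto
qed simp

text \<open>
  A complex form of the diagonal scaling of positive definite matrices, applied to the Gram
  matrix of the \<open>v i\<close>.  The coefficients come from maximising the scale-invariant quotient
  \<open>(\<Prod>i. \<bar>c i\<bar> powr \<alpha> i) / norm (\<Sum>i. c i *\<^sub>C v i)\<close>.  A maximum exists because independence
  keeps the denominator away from \<open>0\<close> on the compact set \<open>(\<Sum>i. \<bar>c i\<bar>) = 1\<close>, and no \<open>c i\<close> vanishes
  at it because the numerator is then positive.  Replacing \<open>c i\<close> by \<open>(1 + s) * c i\<close> for real and for
  imaginary \<open>s\<close>, the first-order conditions at \<open>s = 0\<close> fix the real and the imaginary part of
  \<open>c i * cinner (v i) x\<close>.
\<close>

lemma gram_scaling:
  fixes v :: "'i \<Rightarrow> 'a::complex_inner" and \<alpha> :: "'i \<Rightarrow> real"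
  assumes I: "finite I" "I \<noteq> {}"
    and indep: "\<And>c. (\<Sum>i\<in>I. c i *\<^sub>C v i) = 0 \<Longrightarrow> \<forall>i\<in>I. c i = 0"
    and \<alpha>: "\<And>i. i \<in> I \<Longrightarrow> \<alpha> i > 0" "sum \<alpha> I = 1"
  shows "\<exists>c. norm (\<Sum>i\<in>I. c i *\<^sub>C v i) = 1 \<and>
             (\<forall>i\<in>I. c i * cinner (v i) (\<Sum>k\<in>I. c k *\<^sub>C v k) = \<alpha> i)"
proof -
  \<comment> \<open>\<open>N\<close> normalises the coefficients; \<open>g c / norm (X c)\<close> is the quotient to be maximised over \<open>K\<close>.\<close>
  define X where "X c = (\<Sum>i\<in>I. c i *\<^sub>C v i)" for c :: "'i \<Rightarrow> complex"
  define g where "g c = (\<Prod>i\<in>I. cmod (c i) powr \<alpha> i)" for c :: "'i \<Rightarrow> complex"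
  define N where "N c = (\<Sum>i\<in>I. cmod (c i))" for c :: "'i \<Rightarrow> complex"
  define B where "B = (\<Pi>\<^sub>E i\<in>UNIV. if i \<in> I then cball (0::complex) 1 else {0})"
  define K where "K = B \<inter> {c. N c = 1}"
  have cc [continuous_intros]: "continuous_on A (\<lambda>c::'i \<Rightarrow> complex. c i)" for A i
    by (rule continuous_on_subset[OF continuous_on_product_coordinates]) auto
  have "compact B"
    unfolding B_def using compactin_PiE[of "\<lambda>_::'i. euclidean::complex topology" UNIV "\<lambda>i. if i \<in> I then cball (0::complex) 1 else {0}"]
    by (simp add: euclidean_product_topology)
  moreover have "closed {c. N c = 1}"
    unfolding N_def by (intro closed_Collect_eq continuous_intros)
  ultimately have K: "compact K" unfolding K_def by (rule compact_Int_closed)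
  have X0: "X c \<noteq> 0" if "N c \<noteq> 0" for c
  proof
    assume "X c = 0"
    then have "\<forall>i\<in>I. c i = 0" unfolding X_def by (rule indep)
    then show False using that by (simp add: N_def)
  qed
  have Nscale: "N (\<lambda>i. of_real r * c i) = r * N c" if "r \<ge> 0" for r c
    using that by (simp add: N_def norm_mult sum_distrib_left)
  have Xscale: "X (\<lambda>i. a * c i) = a *\<^sub>C X c" for a c
    by (simp add: X_def scaleC_sum_comp)
  have gscale: "g (\<lambda>i. of_real r * c i) = r * g c" if "r > 0" for r c
  proof -
    have "g (\<lambda>i. of_real r * c i) = (\<Prod>i\<in>I. r powr \<alpha> i) * g c"
      using that by (simp add: g_def norm_mult powr_mult prod.distrib)
    also have "(\<Prod>i\<in>I. r powr \<alpha> i) = r powr (sum \<alpha> I)"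
      using that I by (simp add: powr_sum)
    finally show ?thesis using \<alpha>(2) that by simp
  qed
  have cont: "continuous_on K (\<lambda>c. g c / norm (X c))"
  proof (rule continuous_on_divide)
    show "continuous_on K g"
      unfolding g_def
    proof (rule continuous_on_prod)
      show "continuous_on K (\<lambda>c. cmod (c i) powr \<alpha> i)" if "i \<in> I" for i
        using \<alpha>(1)[OF that] by (intro continuous_on_powr' continuous_intros) auto
    qed
    show "continuous_on K (\<lambda>c. norm (X c))" unfolding X_def
      by (intro continuous_intros scaleC.continuous_on)
    show "\<forall>c\<in>K. norm (X c) \<noteq> 0" using X0 by (auto simp: K_def)
  qed
  \<comment> \<open>Only the values on \<open>I\<close> matter; elsewhere the coordinates are pinned to \<open>0\<close> to stay in \<open>K\<close>.\<close>
  define e where "e = (\<lambda>i. if i \<in> I then complex_of_real (1 / card I) else 0)"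
  have cI: "card I > 0" "real (card I) \<ge> 1" using I by (auto simp: card_gt_0_iff Suc_le_eq)
  have e: "e \<in> K"
    using cI I by (auto simp: K_def B_def e_def N_def norm_divide divide_simps split: if_splits)
  then obtain m where m: "m \<in> K" "\<And>c. c \<in> K \<Longrightarrow> g c / norm (X c) \<le> g m / norm (X m)"
    using continuous_attains_sup[OF K _ cont] by blast
  have Xm: "norm (X m) > 0" using m(1) X0 by (auto simp: K_def)
  have "g e > 0" unfolding g_def using cI I by (intro prod_pos) (auto simp: e_def)
  moreover have "norm (X e) > 0" using e X0 by (auto simp: K_def)
  ultimately have "0 < g e / norm (X e)" by simp
  also have "\<dots> \<le> g m / norm (X m)" by (rule m(2)[OF e])
  finally have gm: "g m > 0" using Xm by (simp add: zero_less_divide_iff)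
  have mnz: "m i \<noteq> 0" if "i \<in> I" for i
    using gm that I by (auto simp: g_def dest!: less_imp_neq)
  have max: "g c * norm (X m) \<le> g m * norm (X c)" for c
  proof (cases "N c = 0")
    case True
    then have "\<forall>i\<in>I. c i = 0" using I by (simp add: N_def sum_nonneg_eq_0_iff)
    then have "g c = 0" using I by (auto simp: g_def)
    then show ?thesis using gm by simp
  next
    case False
    then have Nc: "N c > 0" by (simp add: N_def order_less_le sum_nonneg)
    define r where "r = 1 / N c"
    have r: "r > 0" using Nc by (simp add: r_def)
    define c' where "c' = (\<lambda>i. if i \<in> I then of_real r * c i else 0)"
    have eq: "N c' = N (\<lambda>i. of_real r * c i)" "g c' = g (\<lambda>i. of_real r * c i)"
       "X c' = X (\<lambda>i. of_real r * c i)"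
      by (auto simp: N_def g_def X_def c'_def intro!: sum.cong prod.cong)
    have N1: "N c' = 1" using Nc r by (simp add: eq Nscale) (simp add: r_def)
    have "cmod (c' i) \<le> 1" if "i \<in> I" for i
      using member_le_sum[OF that, of "\<lambda>i. cmod (c' i)"] I N1 by (simp add: N_def)
    then have "c' \<in> K" using N1 by (auto simp: K_def B_def c'_def)
    from m(2)[OF this] have "g c' * norm (X m) \<le> g m * norm (X c')"
      using Xm X0[of c'] N1 by (simp add: divide_simps)
    then have "r * (g c * norm (X m)) \<le> r * (g m * norm (X c))"
      using r by (simp add: eq gscale Xscale norm_scaleC mult_ac)
    then show ?thesis using r by simp
  qed
  define x where "x = (1 / norm (X m)) *\<^sub>R X m"
  define c where "c = (\<lambda>i. of_real (1 / norm (X m)) * m i)"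
  have Xc: "X c = x" unfolding c_def Xscale x_def scaleR_scaleC ..
  have nx: "norm x = 1" using Xm by (simp add: x_def)
  have gc: "g c > 0" unfolding c_def using gm Xm by (subst gscale) auto
  have maxc: "g d \<le> g c * norm (X d)" for d
  proof -
    have "g c = g m / norm (X m)" unfolding c_def using Xm by (subst gscale) auto
    then have "g m = g c * norm (X m)" using Xm by simp
    then have "norm (X m) * g d \<le> norm (X m) * (g c * norm (X d))"
      using max[of d] by (simp only: mult_ac)
    then show ?thesis using Xm by (simp only: mult_le_cancel_left_pos)
  qed
  have "c i * cinner (v i) x = \<alpha> i" if i: "i \<in> I" for i
  proof -
    define w where "w = c i * cinner (v i) x"
    \<comment> \<open>Maximality, squared, at the coefficients with \<open>c i\<close> replaced by \<open>(1 + s) * c i\<close>.\<close>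
    have ineq: "((cmod (1 + s))\<^sup>2) powr \<alpha> i \<le>
        1 + 2 * Re (s * w) + (cmod s)\<^sup>2 * (norm (c i *\<^sub>C v i))\<^sup>2" for s
    proof -
      define d where "d = (\<lambda>k. if k = i then (1 + s) * c i else c k)"
      have "X d = (1 + s) *\<^sub>C c i *\<^sub>C v i + (\<Sum>k\<in>I - {i}. c k *\<^sub>C v k)"
        unfolding X_def using i I
        by (subst sum.remove[of _ i]) (auto simp: d_def scaleC_scaleC intro!: sum.cong)
      moreover have "X c = c i *\<^sub>C v i + (\<Sum>k\<in>I - {i}. c k *\<^sub>C v k)"
        unfolding X_def using i I by (subst sum.remove[of _ i]) auto
      ultimately have Xd: "X d = x + s *\<^sub>C c i *\<^sub>C v i"
        using Xc by (simp add: scaleC_add_left)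
      have "g d = (cmod (1 + s) powr \<alpha> i * cmod (c i) powr \<alpha> i) * (\<Prod>k\<in>I - {i}. cmod (c k) powr \<alpha> k)"
        unfolding g_def using i I
        by (subst prod.remove[of _ i]) (auto simp: d_def norm_mult powr_mult intro!: prod.cong)
      moreover have "g c = cmod (c i) powr \<alpha> i * (\<Prod>k\<in>I - {i}. cmod (c k) powr \<alpha> k)"
        unfolding g_def using i I by (subst prod.remove[of _ i]) auto
      ultimately have "g d = g c * cmod (1 + s) powr \<alpha> i" by simp
      with maxc[of d] gc have "cmod (1 + s) powr \<alpha> i \<le> norm (X d)" by simp
      then have "(cmod (1 + s) powr \<alpha> i)\<^sup>2 \<le> (norm (X d))\<^sup>2" by (simp add: power_mono)
      also have "(cmod (1 + s) powr \<alpha> i)\<^sup>2 = ((cmod (1 + s))\<^sup>2) powr \<alpha> i"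
        by (simp add: power2_eq_square powr_mult)
      also have "(norm (X d))\<^sup>2 = (norm x)\<^sup>2 + 2 * inner (s *\<^sub>C c i *\<^sub>C v i) x + (norm (s *\<^sub>C c i *\<^sub>C v i))\<^sup>2"
        unfolding Xd by (simp add: power2_norm_eq_inner inner_add_left inner_add_right inner_commute)
      also have "inner (s *\<^sub>C c i *\<^sub>C v i) x = Re (s * w)"
        by (simp add: Re_cinner[symmetric] cinner_scaleC_left w_def)
      finally show ?thesis using nx by (simp add: norm_scaleC power_mult_distrib)
    qed
    define b where "b = (norm (c i *\<^sub>C v i))\<^sup>2"
    \<comment> \<open>The inequality for \<open>s = t\<close> and below for \<open>s = \<i> * t\<close>; both functions have a minimum at \<open>0\<close>.\<close>
    define f where "f = (\<lambda>t::real. 1 + 2 * (t * Re w) + t\<^sup>2 * b - ((1 + t)\<^sup>2) powr \<alpha> i)"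
    have "cmod (1 + complex_of_real t) = \<bar>1 + t\<bar>" for t
      by (metis norm_of_real of_real_1 of_real_add)
    then have "f t \<ge> 0" for t
      using ineq[of "of_real t"] by (simp add: f_def b_def)
    moreover have "f 0 = 0" by (simp add: f_def)
    moreover have "(f has_real_derivative (2 * Re w - 2 * \<alpha> i)) (at 0)"
      unfolding f_def by (auto intro!: derivative_eq_intros)
    ultimately have "2 * Re w - 2 * \<alpha> i = 0"
      by (intro DERIV_local_min[of f _ 0 1]) auto
    then have re: "Re w = \<alpha> i" by simp
    define h where "h = (\<lambda>t::real. 1 - 2 * (t * Im w) + t\<^sup>2 * b - (1 + t\<^sup>2) powr \<alpha> i)"
    have "h t \<ge> 0" for t
      using ineq[of "\<i> * of_real t"] by (simp add: h_def b_def cmod_power2 norm_mult)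
    moreover have "h 0 = 0" by (simp add: h_def)
    moreover have "(h has_real_derivative (- 2 * Im w)) (at 0)"
      unfolding h_def by (auto intro!: derivative_eq_intros)
    ultimately have "- 2 * Im w = 0"
      by (intro DERIV_local_min[of h _ 0 1]) auto
    with re have "w = \<alpha> i" by (simp add: complex_eq_iff)
    then show ?thesis by (simp add: w_def)
  qed
  then show ?thesis using nx Xc by (intro exI[of _ c]) (simp add: X_def)
qed

definition form_value :: "('n::finite \<Rightarrow> 'a::complex_inner \<Rightarrow> 'a) \<Rightarrow> 'a \<Rightarrow> complex ^ 'n" where
  "form_value T x = (\<chi> j. cinner (T j x) x)"

text \<open>
  For \<open>x = (\<Sum>\<mu>. c \<mu> *\<^sub>C v \<mu>)\<close> one has \<open>cinner (T j x) x = (\<Sum>\<mu>. \<mu> $ j * (c \<mu> * cinner (v \<mu>) x))\<close>, so a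
  prescribed convex combination of joint eigenvalues is obtained as soon as
  \<open>c \<mu> * cinner (v \<mu>) x\<close> equals the weight of \<open>\<mu>\<close>, which is what \<open>gram_scaling\<close> provides.  The
  scaling needs positive weights, so eigenvalues of weight \<open>0\<close> are dropped first.
\<close>

lemma form_value_joint_eigenvectors:
  fixes T :: "'n::finite \<Rightarrow> 'a::complex_inner \<Rightarrow> 'a" and v :: "complex ^ 'n \<Rightarrow> 'a"
  assumes T: "\<And>j. bounded_clinear (T j)" and F: "finite F"
    and v: "\<And>\<mu> j. \<mu> \<in> F \<Longrightarrow> T j (v \<mu>) = \<mu> $ j *\<^sub>C v \<mu>" "\<And>\<mu>. \<mu> \<in> F \<Longrightarrow> v \<mu> \<noteq> 0"
    and z: "z \<in> convex hull F"
  obtains c where "norm (\<Sum>\<mu>\<in>F. c \<mu> *\<^sub>C v \<mu>) = 1" "form_value T (\<Sum>\<mu>\<in>F. c \<mu> *\<^sub>C v \<mu>) = z"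
proof -
  obtain \<alpha> where \<alpha>: "\<forall>\<mu>\<in>F. 0 \<le> \<alpha> \<mu>" "sum \<alpha> F = 1" "(\<Sum>\<mu>\<in>F. \<alpha> \<mu> *\<^sub>R \<mu>) = z"
    using z by (auto simp: convex_hull_finite[OF F])
  define I where "I = {\<mu> \<in> F. \<alpha> \<mu> > 0}"
  have I: "finite I" "I \<subseteq> F" using F by (auto simp: I_def)
  have out: "\<alpha> \<mu> = 0" if "\<mu> \<in> F - I" for \<mu> using that \<alpha>(1) by (auto simp: I_def)
  have \<alpha>I: "sum \<alpha> I = 1"
    using sum.mono_neutral_left[OF F I(2), of \<alpha>] out \<alpha>(2) by auto
  then have "I \<noteq> {}" by auto
  have ind: "\<forall>\<mu>\<in>I. c \<mu> = 0" if "(\<Sum>\<mu>\<in>I. c \<mu> *\<^sub>C v \<mu>) = 0" for c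
    by (rule joint_eigenvectors_independent[OF T I(1) _ _ that]) (use v I in auto)
  obtain c where c: "norm (\<Sum>\<mu>\<in>I. c \<mu> *\<^sub>C v \<mu>) = 1"
    "\<And>\<mu>. \<mu> \<in> I \<Longrightarrow> c \<mu> * cinner (v \<mu>) (\<Sum>\<mu>\<in>I. c \<mu> *\<^sub>C v \<mu>) = \<alpha> \<mu>"
    using gram_scaling[OF I(1) \<open>I \<noteq> {}\<close> ind _ \<alpha>I] unfolding I_def by blast
  define d where "d \<mu> = (if \<mu> \<in> I then c \<mu> else 0)" for \<mu>
  define x where "x = (\<Sum>\<mu>\<in>I. c \<mu> *\<^sub>C v \<mu>)"
  have x: "x = (\<Sum>\<mu>\<in>F. d \<mu> *\<^sub>C v \<mu>)"
    unfolding x_def using F I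
    by (intro sum.mono_neutral_cong_left) (auto simp: d_def scaleC.zero_left)
  have "cinner (T j x) x = z $ j" for j
  proof -
    have "T j x = (\<Sum>\<mu>\<in>I. c \<mu> *\<^sub>C \<mu> $ j *\<^sub>C v \<mu>)"
      unfolding x_def bounded_clinear_lincomb[OF T] using v I by (intro sum.cong) auto
    then have "cinner (T j x) x = (\<Sum>\<mu>\<in>I. \<mu> $ j * (c \<mu> * cinner (v \<mu>) x))"
      by (simp add: cinner.sum_left cinner_scaleC_left mult_ac)
    also have "\<dots> = (\<Sum>\<mu>\<in>I. \<alpha> \<mu> *\<^sub>R \<mu> $ j)"
      by (intro sum.cong) (auto simp: x_def c scaleR_conv_of_real mult.commute)
    also have "\<dots> = (\<Sum>\<mu>\<in>F. \<alpha> \<mu> *\<^sub>R \<mu> $ j)"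
      using F I out by (intro sum.mono_neutral_left) auto
    also have "\<dots> = z $ j" by (simp flip: \<alpha>(3))
    finally show ?thesis .
  qed
  then have "form_value T x = z" by (simp add: form_value_def vec_eq_iff)
  then show thesis using that[of d] c(1) by (simp flip: x add: x_def[symmetric])
qed

section \<open>Essential numerical values and decoupled vectors\<close>

text \<open>
  Finitely many bounded functionals play the role of a finite-dimensional subspace \<open>M\<close>, and their
  common kernel that of the orthogonal complement of \<open>M\<close>.  This makes it possible to ask for
  \<open>cinner (T j x) y = 0\<close> without introducing the adjoint of \<open>T j\<close>.
\<close>

definition cfunctional :: "('a::complex_inner \<Rightarrow> complex) \<Rightarrow> bool" where
  "cfunctional f \<longleftrightarrow> bounded_linear f \<and> (\<forall>a x. f (a *\<^sub>C x) = a * f x)"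

lemma cfunctional_cinner: "bounded_clinear A \<Longrightarrow> cfunctional (\<lambda>x. cinner (A x) y)"
  by (auto simp: cfunctional_def bounded_clinear_def cinner_scaleC_left
      intro: bounded_linear_compose[OF cinner.bounded_linear_left])

lemma bounded_clinear_id: "bounded_clinear (\<lambda>x. x)"
  by (simp add: bounded_clinear_def)

lemma orthonormal_norm:
  assumes "orthonormal_seq x"
  shows "norm (x k) = 1"
proof -
  have "complex_of_real ((norm (x k))\<^sup>2) = of_real 1"
    using assms by (metis cinner_self of_real_1 orthonormal_seq_def)
  then have "(norm (x k))\<^sup>2 = 1" by (simp only: of_real_eq_iff)
  then show ?thesis by (simp add: power2_eq_1_iff) (use norm_ge_zero[of "x k"] in linarith)
qed

lemma norm_sum_orthonormal:
  assumes "orthonormal_seq x"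
  shows "(norm (\<Sum>k<N. c k *\<^sub>C x k))\<^sup>2 = (\<Sum>k<N. (cmod (c k))\<^sup>2)"
proof (induction N)
  case (Suc N)
  have "cinner (\<Sum>k<N. c k *\<^sub>C x k) (c N *\<^sub>C x N) = 0"
    using assms by (simp add: cinner.sum_left cinner_scaleC_left cinner_scaleC_right orthonormal_seq_def)
  from norm_add_orthogonal[OF this] Suc show ?case
    by (simp add: norm_scaleC orthonormal_norm[OF assms])
qed simp

text \<open>
  Bessel's inequality for a functional: testing \<open>f\<close> on \<open>(\<Sum>k<N. cnj (f (x k)) *\<^sub>C x k)\<close> bounds
  the partial sums of \<open>\<bar>f (x k)\<bar>\<^sup>2\<close> by the square of the norm of \<open>f\<close>.
\<close>

lemma orthonormal_seq_weakly_null: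
  assumes x: "orthonormal_seq x" and f: "cfunctional f"
  shows "(\<lambda>k. f (x k)) \<longlonglongrightarrow> 0"
proof -
  have bl: "bounded_linear f" using f by (simp add: cfunctional_def)
  obtain K where K: "K > 0" "\<And>x. norm (f x) \<le> norm x * K"
    using bounded_linear.pos_bounded[OF bl] by auto
  have bound: "(\<Sum>k<N. (cmod (f (x k)))\<^sup>2) \<le> K\<^sup>2" for N
  proof -
    define s where "s = (\<Sum>k<N. (cmod (f (x k)))\<^sup>2)"
    define z where "z = (\<Sum>k<N. cnj (f (x k)) *\<^sub>C x k)"
    have s0: "s \<ge> 0" by (simp add: s_def sum_nonneg)
    have "f z = (\<Sum>k<N. cnj (f (x k)) * f (x k))"
      using f by (simp add: z_def cfunctional_def linear_sum bounded_linear.linear)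
    also have "\<dots> = of_real s"
      by (simp add: s_def complex_norm_square mult.commute del: of_real_power)
    finally have "s = cmod (f z)" using s0 by simp
    also have "\<dots> \<le> norm z * K" by (rule K)
    finally have "s\<^sup>2 \<le> (norm z * K)\<^sup>2" using s0 by (rule power_mono)
    also have "\<dots> = s * K\<^sup>2"
      unfolding power_mult_distrib z_def by (simp add: norm_sum_orthonormal[OF x] s_def)
    finally have "s * s \<le> s * K\<^sup>2" by (simp add: power2_eq_square)
    then show ?thesis using s0 K by (cases "s = 0") (auto simp: s_def[symmetric])
  qed
  have "summable (\<lambda>k. (cmod (f (x k)))\<^sup>2)"
    by (rule summableI_nonneg_bounded[OF _ bound]) simp
  then have "(\<lambda>k. (cmod (f (x k)))\<^sup>2) \<longlonglongrightarrow> 0" by (rule summable_LIMSEQ_zero)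
  then have "(\<lambda>k. sqrt ((cmod (f (x k)))\<^sup>2)) \<longlonglongrightarrow> sqrt 0" by (rule tendsto_real_sqrt)
  then show ?thesis by (simp add: tendsto_norm_zero_iff)
qed

lemma form_value_perturb:
  assumes T: "\<And>j. bounded_clinear (T j)"
    and y: "(\<lambda>k. norm (y k)) \<longlonglongrightarrow> (1::real)" "(\<lambda>k. form_value T (y k)) \<longlonglongrightarrow> p"
    and c: "c \<longlonglongrightarrow> 0"
  shows "(\<lambda>k. norm (y k - c k *\<^sub>C e)) \<longlonglongrightarrow> 1"
    "(\<lambda>k. form_value T (y k - c k *\<^sub>C e)) \<longlonglongrightarrow> p"
proof -
  have ce: "(\<lambda>k. c k *\<^sub>C e) \<longlonglongrightarrow> 0"
    using scaleC.tendsto[OF c tendsto_const[of e]] by (simp add: scaleC.zero_left)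
  have "(\<lambda>k. norm (y k - c k *\<^sub>C e) - norm (y k)) \<longlonglongrightarrow> 0"
  proof (rule Lim_null_comparison)
    show "\<forall>\<^sub>F k in sequentially. norm (norm (y k - c k *\<^sub>C e) - norm (y k)) \<le> norm (c k *\<^sub>C e)"
      using norm_triangle_ineq3[of "y k - c k *\<^sub>C e" "y k" for k] by simp
    show "(\<lambda>k. norm (c k *\<^sub>C e)) \<longlonglongrightarrow> 0" using ce by (rule tendsto_norm_zero)
  qed
  from tendsto_add[OF this y(1)] show "(\<lambda>k. norm (y k - c k *\<^sub>C e)) \<longlonglongrightarrow> 1" by simp
  have Bf: "Bfun (\<lambda>k. norm (y k)) sequentially"
    using y(1) convergentI Bseq_eq_bounded convergent_imp_Bseq by blast
  then have By: "Bfun y sequentially" by (simp add: Bfun_def)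
  have "(\<lambda>k. cinner (T j (y k - c k *\<^sub>C e)) (y k - c k *\<^sub>C e)) \<longlonglongrightarrow> p $ j" for j
  proof -
    note lin = bounded_clinearD(1)[OF T[of j]]
    interpret form: bounded_bilinear "\<lambda>u v. cinner (T j u) v"
      by (rule cinner.comp1[OF lin])
    have 1: "(\<lambda>k. cinner (T j (y k)) (c k *\<^sub>C e)) \<longlonglongrightarrow> 0"
      using form.Bfun_prod_Zfun[OF By] ce by (simp add: tendsto_Zfun_iff)
    have 2: "(\<lambda>k. cinner (T j (c k *\<^sub>C e)) (y k)) \<longlonglongrightarrow> 0"
      using form.Zfun_prod_Bfun[OF _ By] ce by (simp add: tendsto_Zfun_iff)
    have 3: "(\<lambda>k. cinner (T j (c k *\<^sub>C e)) (c k *\<^sub>C e)) \<longlonglongrightarrow> 0"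
      by (rule form.tendsto_zero[OF ce ce])
    have 0: "(\<lambda>k. cinner (T j (y k)) (y k)) \<longlonglongrightarrow> p $ j"
      using tendsto_vec_nth[OF y(2), of j] by (simp add: form_value_def)
    have "(\<lambda>k. cinner (T j (y k)) (y k) - cinner (T j (y k)) (c k *\<^sub>C e)
       - cinner (T j (c k *\<^sub>C e)) (y k) + cinner (T j (c k *\<^sub>C e)) (c k *\<^sub>C e)) \<longlonglongrightarrow> p $ j - 0 - 0 + 0"
      by (intro tendsto_intros 0 1 2 3)
    then show ?thesis
      by (simp add: linear_simps[OF lin] cinner.diff_left cinner.diff_right algebra_simps)
  qed
  then show "(\<lambda>k. form_value T (y k - c k *\<^sub>C e)) \<longlonglongrightarrow> p"
    by (intro vec_tendstoI) (simp add: form_value_def)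
qed

text \<open>
  The functionals are killed one after the other.  Given one more functional \<open>f\<close>, either it vanishes
  on the common kernel of the previous ones, and then already on the sequence, or that kernel contains
  some \<open>e\<close> with \<open>f e \<noteq> 0\<close>.  In the second case subtracting \<open>(f (y k) / f e) *\<^sub>C e\<close> makes \<open>f\<close> vanish;
  this is a correction in a fixed direction tending to \<open>0\<close>, since the sequence is weakly null, so it
  preserves all the limits.  Weak convergence to \<open>0\<close> is part of the conclusion to keep the
  induction going.
\<close>

lemma essential_value_in_kernel_seq:
  fixes T :: "'n::finite \<Rightarrow> 'a::complex_inner \<Rightarrow> 'a"
  assumes T: "\<And>j. bounded_clinear (T j)"
    and p: "p \<in> joint_essential_numerical_range T"
    and \<Phi>: "finite \<Phi>" "\<And>f. f \<in> \<Phi> \<Longrightarrow> cfunctional f"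
  shows "\<exists>y. (\<forall>k. \<forall>f\<in>\<Phi>. f (y k) = 0) \<and> (\<lambda>k. norm (y k)) \<longlonglongrightarrow> 1 \<and>
    (\<lambda>k. form_value T (y k)) \<longlonglongrightarrow> p \<and> (\<forall>f. cfunctional f \<longrightarrow> (\<lambda>k. f (y k)) \<longlonglongrightarrow> 0)"
  using \<Phi>
proof (induction \<Phi>)
  case empty
  obtain x where x: "orthonormal_seq x" "\<And>j. (\<lambda>k. cinner (T j (x k)) (x k)) \<longlonglongrightarrow> p $ j"
    using p by (auto simp: joint_essential_numerical_range_def)
  have "(\<lambda>k. form_value T (x k)) \<longlonglongrightarrow> p"
    by (intro vec_tendstoI) (simp add: form_value_def x)
  then show ?case
    using orthonormal_norm[OF x(1)] orthonormal_seq_weakly_null[OF x(1)] by (intro exI[of _ x]) auto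
next
  case (insert f \<Phi>)
  then obtain y where y: "\<And>k g. g \<in> \<Phi> \<Longrightarrow> g (y k) = 0" "(\<lambda>k. norm (y k)) \<longlonglongrightarrow> 1"
    "(\<lambda>k. form_value T (y k)) \<longlonglongrightarrow> p" "\<And>g. cfunctional g \<Longrightarrow> (\<lambda>k. g (y k)) \<longlonglongrightarrow> 0"
    by (meson insertI2)
  show ?case
  proof (cases "\<exists>e. (\<forall>g\<in>\<Phi>. g e = 0) \<and> f e \<noteq> 0")
    case False
    then show ?thesis using y by (intro exI[of _ y]) auto
  next
    case True
    then obtain e where e: "\<And>g. g \<in> \<Phi> \<Longrightarrow> g e = 0" "f e \<noteq> 0" by blast
    have f: "cfunctional f" using insert.prems by simp
    define c where "c k = f (y k) / f e" for k
    have c: "c \<longlonglongrightarrow> 0"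
      unfolding c_def using tendsto_divide[OF y(4)[OF f] tendsto_const e(2)] by simp
    have diff: "g (y k - c k *\<^sub>C e) = g (y k) - c k * g e" if "cfunctional g" for g k
      using that by (simp add: cfunctional_def linear_simps)
    have zero: "g (y k - c k *\<^sub>C e) = 0" if "g \<in> insert f \<Phi>" for g k
    proof (cases "g = f")
      case True
      then show ?thesis using diff[OF f, of k] e(2) by (simp add: c_def)
    next
      case False
      then have "g \<in> \<Phi>" "cfunctional g" using that insert.prems by auto
      then show ?thesis using diff[of g k] y(1)[of g k] e(1)[of g] by simp
    qed
    have weak: "(\<lambda>k. g (y k - c k *\<^sub>C e)) \<longlonglongrightarrow> 0" if g: "cfunctional g" for g
      unfolding diff[OF g] using tendsto_diff[OF y(4)[OF g] tendsto_mult[OF c tendsto_const]] by simp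
    show ?thesis
      using zero weak by (intro exI[of _ "\<lambda>k. y k - c k *\<^sub>C e"] conjI form_value_perturb[OF T y(2,3) c]) auto
  qed
qed

lemma form_value_scaleR:
  assumes "\<And>j. bounded_clinear (T j)"
  shows "form_value T (r *\<^sub>R x) = r\<^sup>2 *\<^sub>R form_value T x"
  using bounded_clinearD(1)[OF assms]
  by (simp add: form_value_def vec_eq_iff linear_simps cinner.scaleR_left cinner.scaleR_right power2_eq_square)

lemma essential_value_in_kernel:
  fixes T :: "'n::finite \<Rightarrow> 'a::complex_inner \<Rightarrow> 'a"
  assumes T: "\<And>j. bounded_clinear (T j)"
    and p: "p \<in> joint_essential_numerical_range T"
    and \<Phi>: "finite \<Phi>" "\<And>f. f \<in> \<Phi> \<Longrightarrow> cfunctional f" and "\<epsilon> > 0"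
  obtains u where "norm u = 1" "\<And>f. f \<in> \<Phi> \<Longrightarrow> f u = 0" "dist (form_value T u) p < \<epsilon>"
proof -
  obtain y where y: "\<And>k f. f \<in> \<Phi> \<Longrightarrow> f (y k) = 0" "(\<lambda>k. norm (y k)) \<longlonglongrightarrow> 1"
    "(\<lambda>k. form_value T (y k)) \<longlonglongrightarrow> p"
    using essential_value_in_kernel_seq[OF T p \<Phi>] by blast
  define u where "u k = (1 / norm (y k)) *\<^sub>R y k" for k
  have "(\<lambda>k. (1 / norm (y k))\<^sup>2 *\<^sub>R form_value T (y k)) \<longlonglongrightarrow> (1 / 1)\<^sup>2 *\<^sub>R p"
    by (intro tendsto_intros y) simp
  then have "(\<lambda>k. form_value T (u k)) \<longlonglongrightarrow> p"
    by (simp add: u_def form_value_scaleR[OF T])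
  then have "\<forall>\<^sub>F k in sequentially. dist (form_value T (u k)) p < \<epsilon>"
    using \<open>\<epsilon> > 0\<close> by (rule tendstoD)
  moreover have "\<forall>\<^sub>F k in sequentially. norm (y k) > 0"
    using order_tendstoD(1)[OF y(2), of 0] by simp
  ultimately obtain k where k: "dist (form_value T (u k)) p < \<epsilon>" "norm (y k) > 0"
    by (metis (mono_tags, lifting) eventually_conj eventually_happens' sequentially_bot)
  show thesis
  proof (rule that[OF _ _ k(1)])
    show "norm (u k) = 1" using k(2) by (simp add: u_def)
    show "f (u k) = 0" if "f \<in> \<Phi>" for f
      using y(1)[OF that] \<Phi>(2)[OF that] by (simp add: u_def cfunctional_def linear_simps)
  qed
qed

text \<open>
  \<open>C\<close> consists of values of the quadratic forms at unit vectors \<open>y\<close>, and each \<open>y\<close> is decoupled from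
  the common kernel of \<open>\<Phi>\<close>: for \<open>u\<close> in this kernel the cross terms \<open>cinner (T j u) y\<close> and
  \<open>cinner u (T j y)\<close> vanish, besides \<open>cinner u y\<close>.  A single \<open>\<Phi>\<close> serves all points of \<open>C\<close>.
\<close>

definition realized :: "('n::finite \<Rightarrow> 'a::complex_inner \<Rightarrow> 'a) \<Rightarrow> ('a \<Rightarrow> complex) set \<Rightarrow> (complex ^ 'n) set \<Rightarrow> bool" where
  "realized T \<Phi> C \<longleftrightarrow> (\<forall>z\<in>C. \<exists>y. norm y = 1 \<and> form_value T y = z \<and>
     (\<forall>u. (\<forall>f\<in>\<Phi>. f u = 0) \<longrightarrow> cinner u y = 0 \<and> (\<forall>j. cinner (T j u) y = 0 \<and> cinner u (T j y) = 0)))"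

lemma form_value_decoupled:
  assumes T: "\<And>j. bounded_clinear (T j)"
    and "norm y = 1" "norm u = 1" "cinner u y = 0"
    and d: "\<And>j. cinner (T j u) y = 0" "\<And>j. cinner u (T j y) = 0"
    and s: "s \<ge> 0" "r \<ge> 0" "s + r = 1"
  shows "norm (sqrt s *\<^sub>R u + sqrt r *\<^sub>R y) = 1"
    "form_value T (sqrt s *\<^sub>R u + sqrt r *\<^sub>R y) = s *\<^sub>R form_value T u + r *\<^sub>R form_value T y"
proof -
  have "(norm (sqrt s *\<^sub>R u + sqrt r *\<^sub>R y))\<^sup>2 = 1"
    using assms by (subst norm_add_orthogonal) (auto simp: cinner.scaleR_left cinner.scaleR_right power_mult_distrib)
  then show "norm (sqrt s *\<^sub>R u + sqrt r *\<^sub>R y) = 1"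
    by (simp add: power2_eq_1_iff) (use norm_ge_zero[of "sqrt s *\<^sub>R u + sqrt r *\<^sub>R y"] in linarith)
  have "cinner (T j y) u = 0" for j using d(2)[of j] cinner_commute[of "T j y" u] by simp
  then show "form_value T (sqrt s *\<^sub>R u + sqrt r *\<^sub>R y) = s *\<^sub>R form_value T u + r *\<^sub>R form_value T y"
    using s d(1) linear_simps[OF bounded_clinearD(1)[OF T]]
    by (simp add: form_value_def vec_eq_iff cinner_add_left cinner_add_right cinner.scaleR_left cinner.scaleR_right)
qed

text \<open>
  Choose a unit vector \<open>u\<close> in the common kernel of \<open>\<Phi>\<close> whose value \<open>p'\<close> is close to \<open>p\<close>.  All cross
  terms between \<open>u\<close> and the vectors \<open>y\<close> vanish exactly, so \<open>sqrt s *\<^sub>R u + sqrt r *\<^sub>R y\<close>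
  has the value \<open>s *\<^sub>R p' + r *\<^sub>R form_value T y\<close>: the whole join of \<open>p'\<close> and \<open>C\<close> is reached.
\<close>

lemma realized_insert:
  fixes T :: "'n::finite \<Rightarrow> 'a::complex_inner \<Rightarrow> 'a"
  assumes T: "\<And>j. bounded_clinear (T j)"
    and \<Phi>: "finite \<Phi>" "\<And>f. f \<in> \<Phi> \<Longrightarrow> cfunctional f"
    and C: "convex C" "realized T \<Phi> C"
    and p: "p \<in> joint_essential_numerical_range T" "\<epsilon> > 0"
  obtains p' \<Psi> where "dist p' p < \<epsilon>" "finite \<Psi>" "\<And>f. f \<in> \<Psi> \<Longrightarrow> cfunctional f"
    "realized T \<Psi> (convex hull (insert p' C))"
proof -
  obtain u where u: "norm u = 1" "\<And>f. f \<in> \<Phi> \<Longrightarrow> f u = 0" "dist (form_value T u) p < \<epsilon>"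
    using essential_value_in_kernel[OF T p(1) \<Phi> p(2)] by blast
  define \<Psi> where "\<Psi> = \<Phi> \<union> {\<lambda>x. cinner x u} \<union> range (\<lambda>j x. cinner (T j x) u) \<union> range (\<lambda>j x. cinner x (T j u))"
  have \<Psi>: "finite \<Psi>" "\<And>f. f \<in> \<Psi> \<Longrightarrow> cfunctional f"
    using \<Phi> T by (auto simp: \<Psi>_def intro: cfunctional_cinner bounded_clinear_id)
  have ker: "(\<forall>f\<in>\<Phi>. f w = 0) \<and> cinner w u = 0 \<and> (\<forall>j. cinner (T j w) u = 0 \<and> cinner w (T j u) = 0)"
    if "\<forall>f\<in>\<Psi>. f w = 0" for w using that by (auto simp: \<Psi>_def)
  have "\<exists>x. norm x = 1 \<and> form_value T x = z \<and>
     (\<forall>w. (\<forall>f\<in>\<Psi>. f w = 0) \<longrightarrow> cinner w x = 0 \<and> (\<forall>j. cinner (T j w) x = 0 \<and> cinner w (T j x) = 0))"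
    if z: "z \<in> convex hull (insert (form_value T u) C)" for z
  proof (cases "C = {}")
    case True
    then show ?thesis using z u ker by (intro exI[of _ u]) auto
  next
    case False
    then obtain s r b where srb: "s \<ge> 0" "r \<ge> 0" "s + r = 1" "b \<in> C"
      "z = s *\<^sub>R form_value T u + r *\<^sub>R b"
      using z C(1) unfolding convex_hull_insert[OF False] by (auto simp: hull_same)
    obtain y where y: "norm y = 1" "form_value T y = b"
      "\<And>u. (\<forall>f\<in>\<Phi>. f u = 0) \<Longrightarrow> cinner u y = 0 \<and> (\<forall>j. cinner (T j u) y = 0 \<and> cinner u (T j y) = 0)"
      using C(2) srb(4) unfolding realized_def by blast
    define x where "x = sqrt s *\<^sub>R u + sqrt r *\<^sub>R y"
    have uy: "cinner u y = 0" "cinner (T j u) y = 0" "cinner u (T j y) = 0" for j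
      using y(3)[of u] u(2) by auto
    have "norm x = 1" "form_value T x = z"
      unfolding x_def srb(5) using form_value_decoupled[OF T y(1) u(1) uy srb(1-3)] y(2) by auto
    moreover have "cinner w x = 0 \<and> (\<forall>j. cinner (T j w) x = 0 \<and> cinner w (T j x) = 0)"
      if "\<forall>f\<in>\<Psi>. f w = 0" for w
      using ker[OF that] y(3)[of w] linear_simps[OF bounded_clinearD(1)[OF T]]
      by (simp add: x_def cinner_add_right cinner.scaleR_right)
    ultimately show ?thesis by blast
  qed
  then have "realized T \<Psi> (convex hull (insert (form_value T u) C))" by (simp add: realized_def)
  with u(3) \<Psi> that show thesis by blast
qed

lemma realized_perturbation:
  fixes T :: "'n::finite \<Rightarrow> 'a::complex_inner \<Rightarrow> 'a"
  assumes T: "\<And>j. bounded_clinear (T j)"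
    and \<Phi>: "finite \<Phi>" "\<And>f. f \<in> \<Phi> \<Longrightarrow> cfunctional f"
    and Q: "realized T \<Phi> (convex hull Q)"
    and "\<epsilon> > 0"
    and "finite P" "P \<subseteq> joint_essential_numerical_range T"
  shows "\<exists>g \<Psi>. (\<forall>p\<in>P. dist (g p) p < \<epsilon>) \<and> finite \<Psi> \<and> (\<forall>f\<in>\<Psi>. cfunctional f) \<and>
            realized T \<Psi> (convex hull (g ` P \<union> Q))"
  using assms(6,7)
proof (induction P)
  case empty
  then show ?case using \<Phi> Q by auto
next
  case (insert p P)
  then obtain g \<Psi> where g: "\<And>q. q \<in> P \<Longrightarrow> dist (g q) q < \<epsilon>" "finite \<Psi>" "\<And>f. f \<in> \<Psi> \<Longrightarrow> cfunctional f"
    "realized T \<Psi> (convex hull (g ` P \<union> Q))" by (metis insert_subset)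
  obtain p' \<Omega> where p': "dist p' p < \<epsilon>" "finite \<Omega>" "\<And>f. f \<in> \<Omega> \<Longrightarrow> cfunctional f"
    "realized T \<Omega> (convex hull (insert p' (convex hull (g ` P \<union> Q))))"
    using realized_insert[OF T g(2,3) convex_convex_hull g(4) _ \<open>\<epsilon> > 0\<close>, of p] insert.prems by auto
  have "convex hull (insert p' (g ` P \<union> Q)) \<subseteq> convex hull (insert p' (convex hull (g ` P \<union> Q)))"
    by (intro hull_mono insert_mono hull_subset)
  then have "realized T \<Omega> (convex hull (insert p' (g ` P \<union> Q)))"
    using p'(4) unfolding realized_def by blast
  moreover have "insert p' (g ` P \<union> Q) = (g(p := p')) ` insert p P \<union> Q"
    using insert.hyps by auto
  ultimately show ?case
    using g p' insert.hyps by (intro exI[of _ "g(p := p')"] exI[of _ \<Omega>]) auto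
qed

section \<open>Interior points of convex hulls\<close>

text \<open>
  If a ball around \<open>z\<close> lies in the convex hull of \<open>S\<close>, then for every unit vector \<open>a\<close> some
  \<open>x \<in> S\<close> lies beyond \<open>z\<close> in direction \<open>- a\<close> by at least a fixed amount.  For a given \<open>x\<close> this is an
  open condition on \<open>a\<close>, so by compactness of the sphere finitely many \<open>x\<close> suffice; small
  displacements of them leave no direction in which \<open>z\<close> could be separated from their hull.
\<close>

lemma interior_convex_hull_stable:
  fixes S :: "'e::euclidean_space set"
  assumes "z \<in> interior (convex hull S)"
  shows "\<exists>F \<epsilon>. finite F \<and> F \<subseteq> S \<and> \<epsilon> > 0 \<and>
           (\<forall>f. (\<forall>x\<in>F. dist (f x) x < \<epsilon>) \<longrightarrow> z \<in> convex hull (f ` F))"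
proof -
  obtain e where e: "e > 0" "cball z e \<subseteq> convex hull S"
    using assms by (auto simp: mem_interior_cball)
  define \<epsilon> where "\<epsilon> = e / 2"
  define U where "U x = {a. inner a x < inner a z - \<epsilon>}" for x
  have "sphere 0 1 \<subseteq> (\<Union>x\<in>S. U x)"
  proof
    fix a :: 'e assume a: "a \<in> sphere 0 1"
    have "\<exists>x\<in>S. inner a x < inner a z - \<epsilon>"
    proof (rule ccontr)
      assume "\<not> ?thesis"
      then have "S \<subseteq> {x. inner a x \<ge> inner a z - \<epsilon>}" by force
      then have "convex hull S \<subseteq> {x. inner a x \<ge> inner a z - \<epsilon>}"
        by (rule hull_minimal) (rule convex_halfspace_ge)
      moreover have "z - e *\<^sub>R a \<in> convex hull S"
        using e a by (auto simp: dist_norm intro!: subsetD[OF e(2)])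
      ultimately have "inner a (z - e *\<^sub>R a) \<ge> inner a z - \<epsilon>" by blast
      moreover have "inner a a = 1" using a by (simp add: norm_eq_1)
      ultimately show False using e by (simp add: inner_diff_right \<epsilon>_def)
    qed
    then show "a \<in> (\<Union>x\<in>S. U x)" by (simp add: U_def)
  qed
  moreover have "open (U x)" for x
    unfolding U_def by (intro open_Collect_less continuous_intros)
  ultimately obtain F where F: "F \<subseteq> S" "finite F" "sphere 0 1 \<subseteq> (\<Union>x\<in>F. U x)"
    using compactE_image[OF compact_sphere, of S U] by metis
  show ?thesis
  proof (intro exI[of _ F] exI[of _ \<epsilon>] conjI F allI impI)
    show "\<epsilon> > 0" using e by (simp add: \<epsilon>_def)
    fix f assume f: "\<forall>x\<in>F. dist (f x) x < \<epsilon>"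
    show "z \<in> convex hull (f ` F)"
    proof (rule ccontr)
      assume "z \<notin> convex hull (f ` F)"
      moreover have "closed (convex hull (f ` F))"
        using F(2) by (intro compact_imp_closed finite_imp_compact_convex_hull) auto
      ultimately obtain a b where ab: "inner a z < b" "\<And>x. x \<in> convex hull (f ` F) \<Longrightarrow> inner a x > b"
        using separating_hyperplane_closed_point[OF convex_convex_hull] by metis
      obtain w where w: "w \<in> sphere (0::'e) 1" using F(3)
        by (metis SOME_Basis mem_sphere_0 norm_Basis)
      have "F \<noteq> {}" using F(3) w by auto
      then obtain x0 where x0: "x0 \<in> F" by blast
      have "a \<noteq> 0" using ab(1) ab(2)[OF hull_inc, of "f x0"] x0 by auto
      define a' where "a' = (1 / norm a) *\<^sub>R a"
      have a': "a' \<in> sphere 0 1" using \<open>a \<noteq> 0\<close> by (simp add: a'_def)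
      then obtain x where x: "x \<in> F" "inner a' x < inner a' z - \<epsilon>"
        using F(3) by (auto simp: U_def)
      have "inner a z < inner a (f x)" using ab(1) ab(2)[OF hull_inc, of "f x"] x(1) by force
      then have "inner a' z < inner a' (f x)" using \<open>a \<noteq> 0\<close> by (simp add: a'_def divide_strict_right_mono)
      moreover have "inner a' (f x - x) \<le> norm a' * norm (f x - x)" by (rule norm_cauchy_schwarz)
      then have "inner a' (f x) - inner a' x < \<epsilon>"
        using bspec[OF f x(1)] a' by (simp add: inner_diff_right dist_norm)
      ultimately show False using x(2) by simp
    qed
  qed
qed

text \<open>
  The essential numerical values are reached only up to \<open>\<epsilon>\<close>, the joint eigenvalues exactly; at an
  interior point of the hull the errors are harmless by \<open>interior_convex_hull_stable\<close>.
\<close>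

lemma interior_hull_subset_numerical_range:
  fixes T :: "'n::finite \<Rightarrow> 'a::complex_inner \<Rightarrow> 'a"
  assumes T: "\<And>j. bounded_clinear (T j)"
  shows "interior (convex hull (joint_essential_numerical_range T \<union> joint_point_spectrum T))
           \<subseteq> joint_numerical_range T"
proof
  fix z assume "z \<in> interior (convex hull (joint_essential_numerical_range T \<union> joint_point_spectrum T))"
  from interior_convex_hull_stable[OF this]
  obtain F \<epsilon> where F: "finite F" "F \<subseteq> joint_essential_numerical_range T \<union> joint_point_spectrum T"
    "\<epsilon> > 0" "\<forall>f. (\<forall>x\<in>F. dist (f x) x < \<epsilon>) \<longrightarrow> z \<in> convex hull (f ` F)"
    by (elim exE conjE)
  define Q where "Q = F \<inter> joint_point_spectrum T"
  have "\<exists>x. x \<noteq> 0 \<and> (\<forall>j. T j x = \<mu> $ j *\<^sub>C x)" if "\<mu> \<in> Q" for \<mu>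
  proof -
    have "(\<Inter>j. {x. T j x - \<mu> $ j *\<^sub>C x = 0}) \<noteq> {0}"
      using that by (simp add: Q_def joint_point_spectrum_def)
    moreover have "0 \<in> (\<Inter>j. {x. T j x - \<mu> $ j *\<^sub>C x = 0})"
      using bounded_clinearD(1)[OF T] by (simp add: linear_simps scaleC.zero_right)
    ultimately show ?thesis by fastforce
  qed
  then obtain v where v: "\<And>\<mu>. \<mu> \<in> Q \<Longrightarrow> v \<mu> \<noteq> 0" "\<And>\<mu> j. \<mu> \<in> Q \<Longrightarrow> T j (v \<mu>) = \<mu> $ j *\<^sub>C v \<mu>"
    by metis
  define \<Phi> where "\<Phi> = (\<lambda>\<mu> x. cinner x (v \<mu>)) ` Q \<union> (\<lambda>(\<mu>, j) x. cinner (T j x) (v \<mu>)) ` (Q \<times> UNIV)"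
  have Qf: "finite Q" using F(1) by (simp add: Q_def)
  have \<Phi>: "finite \<Phi>" "\<And>f. f \<in> \<Phi> \<Longrightarrow> cfunctional f"
    using Qf T by (auto simp: \<Phi>_def intro: cfunctional_cinner bounded_clinear_id)
  have R: "realized T \<Phi> (convex hull Q)"
    unfolding realized_def
  proof
    fix w assume w: "w \<in> convex hull Q"
    obtain c where c: "norm (\<Sum>\<mu>\<in>Q. c \<mu> *\<^sub>C v \<mu>) = 1" "form_value T (\<Sum>\<mu>\<in>Q. c \<mu> *\<^sub>C v \<mu>) = w"
      using form_value_joint_eigenvectors[OF T Qf v(2,1) w] by blast
    have 1: "T j (\<Sum>\<mu>\<in>Q. c \<mu> *\<^sub>C v \<mu>) = (\<Sum>\<mu>\<in>Q. (c \<mu> * \<mu> $ j) *\<^sub>C v \<mu>)" for j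
      unfolding bounded_clinear_lincomb[OF T] using v by (intro sum.cong) (auto simp: scaleC_scaleC)
    have 2: "cinner u (v \<mu>) = 0 \<and> cinner (T j u) (v \<mu>) = 0"
      if "\<forall>f\<in>\<Phi>. f u = 0" "\<mu> \<in> Q" for u \<mu> j
    proof -
      have "(\<lambda>x. cinner x (v \<mu>)) \<in> \<Phi>" "(\<lambda>x. cinner (T j x) (v \<mu>)) \<in> \<Phi>"
        using that(2) by (auto simp: \<Phi>_def)
      from that(1)[rule_format, OF this(1)] that(1)[rule_format, OF this(2)] show ?thesis by simp
    qed
    show "\<exists>y. norm y = 1 \<and> form_value T y = w \<and> (\<forall>u. (\<forall>f\<in>\<Phi>. f u = 0) \<longrightarrow> 
       cinner u y = 0 \<and> (\<forall>j. cinner (T j u) y = 0 \<and> cinner u (T j y) = 0))"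
      using c by (intro exI[of _ "\<Sum>\<mu>\<in>Q. c \<mu> *\<^sub>C v \<mu>"])
        (simp add: 1 2 cinner.sum_right cinner_scaleC_right)
  qed
  obtain g \<Psi> where g: "\<And>p. p \<in> F - Q \<Longrightarrow> dist (g p) p < \<epsilon>" "realized T \<Psi> (convex hull (g ` (F - Q) \<union> Q))"
  proof -
    have "F - Q \<subseteq> joint_essential_numerical_range T" using F(2) by (auto simp: Q_def)
    with F(1) have "\<exists>g \<Psi>. (\<forall>p\<in>F - Q. dist (g p) p < \<epsilon>) \<and> finite \<Psi> \<and> (\<forall>f\<in>\<Psi>. cfunctional f) \<and>
        realized T \<Psi> (convex hull (g ` (F - Q) \<union> Q))"
      by (intro realized_perturbation[OF T \<Phi> R F(3)]) auto
    then obtain g \<Psi> where "\<forall>p\<in>F - Q. dist (g p) p < \<epsilon>" "realized T \<Psi> (convex hull (g ` (F - Q) \<union> Q))"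
      by (elim exE conjE)
    then show thesis by (intro that) auto
  qed
  \<comment> \<open>Joint eigenvalues stay fixed; only the remaining, essential points are displaced.\<close>
  define f where "f x = (if x \<in> Q then x else g x)" for x
  have "\<forall>x\<in>F. dist (f x) x < \<epsilon>" using F(3) g(1) by (auto simp: f_def)
  then have "z \<in> convex hull (f ` F)" using F(4) by simp
  also have "f ` F = g ` (F - Q) \<union> Q" by (auto simp: f_def Q_def)
  finally obtain y where "norm y = 1" "form_value T y = z"
    using g(2) by (auto simp: realized_def)
  then show "z \<in> joint_numerical_range T" by (auto simp: joint_numerical_range_def form_value_def)
qed

section \<open>Joint eigenvectors in finite-dimensional invariant subspaces\<close>

text \<open>
  Finite dimension of a subspace \<open>V\<close> is expressed below by \<open>V \<inter> ortho E = {0}\<close> for a finite set \<open>E\<close>.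
\<close>

definition ortho :: "'a::complex_inner set \<Rightarrow> 'a set" where
  "ortho E = {x. \<forall>e\<in>E. cinner x e = 0}"

definition csubspace :: "'a::complex_inner set \<Rightarrow> bool" where
  "csubspace V \<longleftrightarrow> 0 \<in> V \<and> (\<forall>x\<in>V. \<forall>y\<in>V. x + y \<in> V) \<and> (\<forall>a. \<forall>x\<in>V. a *\<^sub>C x \<in> V)"

lemma csubspace_ortho: "csubspace (ortho E)"
  by (auto simp: csubspace_def ortho_def cinner.zero_left cinner_add_left cinner_scaleC_left)

lemma csubspace_sum:
  "csubspace V \<Longrightarrow> (\<And>i. i \<in> I \<Longrightarrow> f i \<in> V) \<Longrightarrow> sum f I \<in> V"
  by (induction I rule: infinite_finite_induct) (auto simp: csubspace_def)

definition poly_apply :: "complex poly \<Rightarrow> ('a::complex_inner \<Rightarrow> 'a) \<Rightarrow> 'a \<Rightarrow> 'a" where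
  "poly_apply p A w = (\<Sum>i\<le>degree p. coeff p i *\<^sub>C (A ^^ i) w)"

lemma poly_apply_bound:
  "degree p \<le> n \<Longrightarrow> poly_apply p A w = (\<Sum>i\<le>n. coeff p i *\<^sub>C (A ^^ i) w)"
  unfolding poly_apply_def
  by (intro sum.mono_neutral_left) (auto simp: coeff_eq_0 scaleC.zero_left)

lemma poly_apply_add: "poly_apply (p + q) A w = poly_apply p A w + poly_apply q A w"
proof -
  define n where "n = max (degree p) (degree q)"
  have "degree (p + q) \<le> n" "degree p \<le> n" "degree q \<le> n"
    by (auto simp: n_def degree_add_le_max)
  then show ?thesis by (simp add: poly_apply_bound[where n = n] scaleC_add_left sum.distrib)
qed

lemma poly_apply_smult: "poly_apply (smult a p) A w = a *\<^sub>C poly_apply p A w"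
  unfolding poly_apply_bound[OF degree_smult_le] poly_apply_def scaleC_sum_comp
  by (simp add: scaleC.zero_left)

lemma poly_apply_shift:
  assumes "bounded_clinear A"
  shows "poly_apply (pCons 0 p) A w = A (poly_apply p A w)"
proof -
  have "poly_apply (pCons 0 p) A w = (\<Sum>i\<le>Suc (degree p). coeff (pCons 0 p) i *\<^sub>C (A ^^ i) w)"
    by (rule poly_apply_bound) (rule degree_pCons_le)
  also have "\<dots> = (\<Sum>i\<le>degree p. coeff p i *\<^sub>C A ((A ^^ i) w))"
    by (subst sum.atMost_Suc_shift) (simp add: scaleC.zero_left)
  also have "\<dots> = A (poly_apply p A w)"
    by (simp add: poly_apply_def bounded_clinear_lincomb[OF assms])
  finally show ?thesis .
qed

lemma poly_apply_linear_factor: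
  assumes "bounded_clinear A"
  shows "poly_apply ([:- z, 1:] * q) A w = A (poly_apply q A w) - z *\<^sub>C poly_apply q A w"
proof -
  have "[:- z, 1:] * q = pCons 0 q + smult (- z) q" by simp
  then show ?thesis
    by (simp only: poly_apply_add poly_apply_smult poly_apply_shift[OF assms]) (simp add: scaleC.minus_left)
qed

lemma poly_apply_in:
  assumes "csubspace V" "\<And>x. x \<in> V \<Longrightarrow> A x \<in> V" "w \<in> V"
  shows "poly_apply p A w \<in> V"
proof -
  have "(A ^^ i) w \<in> V" for i by (induction i) (use assms in auto)
  then show ?thesis unfolding poly_apply_def
    using assms(1) by (intro csubspace_sum) (auto simp: csubspace_def)
qed

text \<open>
  Each element of \<open>E\<close> imposes one linear condition on polynomials, and finitely many such conditions
  leave solutions of arbitrarily large degree: from two solutions of different degrees a combination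
  meets the next condition, and its degree is that of one of the two.
\<close>

lemma poly_apply_ortho:
  assumes "finite E"
  shows "\<exists>p. p \<noteq> 0 \<and> n \<le> degree p \<and> poly_apply p A w \<in> ortho E"
  using assms
proof (induction E arbitrary: n)
  case empty
  show ?case by (rule exI[of _ "monom 1 n"]) (simp add: ortho_def degree_monom_eq)
next
  case (insert e E)
  obtain p where p: "p \<noteq> 0" "n \<le> degree p" "poly_apply p A w \<in> ortho E" using insert.IH by blast
  obtain q where q: "q \<noteq> 0" "Suc (degree p) \<le> degree q" "poly_apply q A w \<in> ortho E"
    using insert.IH by blast
  define a where "a = cinner (poly_apply p A w) e"
  define b where "b = cinner (poly_apply q A w) e"
  show ?case
  proof (cases "a = 0")
    case True
    then show ?thesis using p by (intro exI[of _ p]) (auto simp: ortho_def a_def)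
  next
    case False
    define r where "r = smult (- (b / a)) p + q"
    have r: "poly_apply r A w = (- (b / a)) *\<^sub>C poly_apply p A w + poly_apply q A w"
      by (simp only: r_def poly_apply_add poly_apply_smult)
    have "degree r = degree q"
      unfolding r_def using q(2) degree_smult_le[of "- (b / a)" p]
      by (intro degree_add_eq_right) simp
    moreover have "poly_apply r A w \<in> ortho (insert e E)"
      using p(3) q(3) False
      by (auto simp: r ortho_def cinner_add_left cinner_scaleC_left
          a_def[symmetric] b_def[symmetric])
    moreover have "r \<noteq> 0" using \<open>degree r = degree q\<close> q(2) by (metis degree_0 not_less_eq_eq zero_le)
    ultimately show ?thesis using p(2) q(2) by (intro exI[of _ r]) auto
  qed
qed

text \<open>
  Take a nonzero polynomial \<open>p\<close> of least degree with \<open>p(A) w = 0\<close> and split off a root \<open>z\<close> as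
  \<open>p = (X - z) q\<close>.  Then \<open>q(A) w \<noteq> 0\<close> by minimality, and it is an eigenvector for \<open>z\<close>.
\<close>

lemma eigenvector_exists:
  assumes A: "bounded_clinear A" and V: "csubspace V" "\<And>x. x \<in> V \<Longrightarrow> A x \<in> V"
    and E: "finite E" "V \<inter> ortho E = {0}" and w: "w \<in> V" "w \<noteq> 0"
  obtains x z where "x \<in> V" "x \<noteq> 0" "A x = z *\<^sub>C x"
proof -
  define P where "P p \<longleftrightarrow> p \<noteq> 0 \<and> poly_apply p A w = 0" for p
  have "\<exists>p. P p"
    using poly_apply_ortho[OF E(1), of 0 A w] poly_apply_in[OF V w(1)] E(2) by (auto simp: P_def)
  then obtain p where p: "P p" and min: "\<And>q. P q \<Longrightarrow> degree p \<le> degree q"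
    using ex_has_least_nat[of P _ degree] by blast
  have "degree p \<noteq> 0"
  proof
    assume d: "degree p = 0"
    then have "coeff p 0 *\<^sub>C w = 0" using p by (simp add: P_def poly_apply_def)
    then show False using p w d by (auto simp: P_def) (metis d leading_coeff_0_iff)
  qed
  then have "\<not> constant (poly p)" by (simp add: constant_degree)
  then obtain z where "poly p z = 0" using fundamental_theorem_of_algebra by blast
  then obtain q where q: "p = [:- z, 1:] * q" by (auto simp: poly_eq_0_iff_dvd dvd_def)
  have "q \<noteq> 0" using p q by (auto simp: P_def)
  then have "degree p = Suc (degree q)" unfolding q by (subst degree_mult_eq) auto
  then have "\<not> P q" using min[of q] by auto
  show thesis
  proof (rule that)
    show "poly_apply q A w \<noteq> 0" using \<open>\<not> P q\<close> \<open>q \<noteq> 0\<close> by (simp add: P_def)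
    show "A (poly_apply q A w) = z *\<^sub>C poly_apply q A w"
      using p poly_apply_linear_factor[OF A, of z q w] by (simp only: P_def q[symmetric]) simp
    show "poly_apply q A w \<in> V" using poly_apply_in[OF V w(1)] .
  qed
qed

text \<open>
  By commutativity the eigenspace of \<open>T i\<close> in \<open>V\<close> is again invariant under the whole tuple, so the
  operators can be treated one at a time.
\<close>

lemma joint_eigenvector_exists:
  fixes T :: "'n \<Rightarrow> 'a::complex_inner \<Rightarrow> 'a"
  assumes T: "\<And>j. bounded_clinear (T j)" and comm: "\<And>i j x. T i (T j x) = T j (T i x)"
    and E: "finite E" and "finite J"
    and "csubspace V" "\<And>j x. x \<in> V \<Longrightarrow> T j x \<in> V" "V \<inter> ortho E = {0}" "V \<noteq> {0}"
  shows "\<exists>x\<in>V. x \<noteq> 0 \<and> (\<exists>\<kappa>. \<forall>j\<in>J. T j x = \<kappa> j *\<^sub>C x)"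
  using assms(4-)
proof (induction J arbitrary: V)
  case empty
  then show ?case by (auto simp: csubspace_def)
next
  case (insert i J)
  obtain w where "w \<in> V" "w \<noteq> 0" using insert.prems by (auto simp: csubspace_def)
  then obtain x z where x: "x \<in> V" "x \<noteq> 0" "T i x = z *\<^sub>C x"
    using eigenvector_exists[OF T insert.prems(1,2) E insert.prems(3)] by metis
  define U where "U = {x \<in> V. T i x = z *\<^sub>C x}"
  note lin = linear_simps[OF bounded_clinearD(1)[OF T]]
  have V: "0 \<in> V" "\<And>x y. x \<in> V \<Longrightarrow> y \<in> V \<Longrightarrow> x + y \<in> V" "\<And>a x. x \<in> V \<Longrightarrow> a *\<^sub>C x \<in> V"
    using insert.prems(1) by (auto simp: csubspace_def)
  have "csubspace U"
    unfolding csubspace_def U_def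
    by (auto simp: V lin scaleC.zero_right scaleC_add_right bounded_clinearD(2)[OF T] scaleC_scaleC mult.commute)
  moreover have "T j y \<in> U" if "y \<in> U" for j y
  proof -
    have y: "y \<in> V" "T i y = z *\<^sub>C y" using that by (auto simp: U_def)
    have "T i (T j y) = z *\<^sub>C T j y"
      by (subst comm) (simp only: y(2) bounded_clinearD(2)[OF T])
    then show ?thesis using insert.prems(2)[OF y(1)] by (simp add: U_def)
  qed
  moreover have "0 \<in> U" using \<open>csubspace U\<close> by (simp add: csubspace_def)
  then have "U \<inter> ortho E = {0}"
    using insert.prems(3) unfolding U_def by blast
  moreover have "U \<noteq> {0}" using x by (auto simp: U_def)
  ultimately have "\<exists>y\<in>U. y \<noteq> 0 \<and> (\<exists>\<kappa>. \<forall>j\<in>J. T j y = \<kappa> j *\<^sub>C y)"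
    by (rule insert.IH)
  then obtain y \<kappa> where y: "y \<in> U" "y \<noteq> 0" "\<forall>j\<in>J. T j y = \<kappa> j *\<^sub>C y"
    by (elim bexE conjE exE)
  then have "\<forall>j\<in>insert i J. T j y = (\<kappa>(i := z)) j *\<^sub>C y"
    using insert.hyps by (auto simp: U_def)
  moreover have "y \<in> V" using y(1) by (simp add: U_def)
  ultimately show ?case using y(2) by (intro bexI[of _ y] conjI exI[of _ "\<kappa>(i := z)"])
qed

section \<open>Approximate kernels\<close>

definition bounded_below_on :: "'a::complex_inner set \<Rightarrow> ('a \<Rightarrow> 'a) \<Rightarrow> bool" where
  "bounded_below_on M A \<longleftrightarrow> (\<exists>c>0. \<forall>x\<in>M. c * norm x \<le> norm (A x))"

lemma not_bounded_below_on_unit: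
  assumes A: "bounded_clinear A" and M: "csubspace M"
    and "\<not> bounded_below_on M A" "\<epsilon> > 0"
  shows "\<exists>x\<in>M. norm x = 1 \<and> norm (A x) < \<epsilon>"
proof -
  obtain x where x: "x \<in> M" "norm (A x) < \<epsilon> * norm x"
    using assms(3,4) unfolding bounded_below_on_def by (meson not_le)
  then have nx: "norm x > 0" by auto
  define y where "y = (1 / norm x) *\<^sub>R x"
  have "y \<in> M" using M x(1) by (simp add: y_def csubspace_def scaleR_scaleC)
  moreover have "norm y = 1" using nx by (simp add: y_def)
  moreover have "norm (A y) < \<epsilon>"
    using x(2) nx linear_simps[OF bounded_clinearD(1)[OF A]] by (simp add: y_def field_simps)
  ultimately show ?thesis by blast
qed

text \<open>
  \<open>ortho E\<close> exceeds \<open>ortho (insert e E)\<close> by at most one direction \<open>h\<close>.  If \<open>A\<close> were not bounded below on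
  \<open>ortho E\<close>, there would be unit vectors \<open>x k\<close> with \<open>A (x k) \<longlonglongrightarrow> 0\<close>.  Along a subsequence their
  \<open>h\<close>-components converge; then so do the components in \<open>ortho (insert e E)\<close>, where \<open>A\<close> is bounded
  below, and the limit is a unit vector annihilated by \<open>A\<close>, against injectivity.
\<close>

lemma bounded_below_extend:
  fixes A :: "'a::complex_hilbert_space \<Rightarrow> 'a"
  assumes A: "bounded_clinear A" and bb: "bounded_below_on (ortho (insert e E)) A"
    and inj: "\<And>x. x \<in> ortho E \<Longrightarrow> A x = 0 \<Longrightarrow> x = 0"
  shows "bounded_below_on (ortho E) A"
proof (rule ccontr)
  assume not: "\<not> ?thesis"
  note lin = linear_simps[OF bounded_clinearD(1)[OF A]]
  have "ortho (insert e E) \<noteq> ortho E" using not bb by metis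
  then obtain h0 where h0: "h0 \<in> ortho E" "cinner h0 e \<noteq> 0" by (auto simp: ortho_def)
  define h where "h = (1 / cinner h0 e) *\<^sub>C h0"
  have h: "h \<in> ortho E" "cinner h e = 1"
    using h0 csubspace_ortho[of E] by (auto simp: h_def csubspace_def cinner_scaleC_left)
  obtain c where c: "c > 0" "\<And>x. x \<in> ortho (insert e E) \<Longrightarrow> c * norm x \<le> norm (A x)"
    using bb by (auto simp: bounded_below_on_def)
  have "\<exists>x\<in>ortho E. norm x = 1 \<and> norm (A x) < 1 / real (Suc k)" for k
    by (rule not_bounded_below_on_unit[OF A csubspace_ortho not]) simp
  then obtain x where x: "\<And>k. x k \<in> ortho E" "\<And>k. norm (x k) = 1" "\<And>k. norm (A (x k)) < 1 / real (Suc k)"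
    by metis
  have Ax: "(\<lambda>k. A (x k)) \<longlonglongrightarrow> 0"
    by (rule LIMSEQ_norm_0) (use x(3) in auto)
  have "bounded (range (\<lambda>k. cinner (x k) e))"
    using cmod_cinner_le[of "x _" e] x(2) by (intro boundedI[of _ "norm e"]) auto
  then obtain t r where r: "strict_mono r" "((\<lambda>k. cinner (x k) e) \<circ> r) \<longlonglongrightarrow> t"
    using bounded_imp_convergent_subsequence by blast
  define a where "a k = cinner (x (r k)) e" for k
  have a: "a \<longlonglongrightarrow> t" using r(2) unfolding a_def[abs_def] comp_def .
  define n where "n k = x (r k) - a k *\<^sub>C h" for k
  have n: "n k - n l \<in> ortho (insert e E)" for k l
    using x(1) h by (auto simp: n_def ortho_def cinner.diff_left cinner_scaleC_left a_def)
  have Axr: "(\<lambda>k. A (x (r k))) \<longlonglongrightarrow> 0"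
    using LIMSEQ_subseq_LIMSEQ[OF Ax r(1)] by (simp add: comp_def)
  have "(\<lambda>k. A (x (r k)) - a k *\<^sub>C A h) \<longlonglongrightarrow> 0 - t *\<^sub>C A h"
    by (intro tendsto_diff Axr scaleC.tendsto a tendsto_const)
  then have "(\<lambda>k. A (n k)) \<longlonglongrightarrow> - (t *\<^sub>C A h)"
    by (simp add: n_def lin bounded_clinearD(2)[OF A])
  then have "Cauchy (\<lambda>k. A (n k))" by (intro convergent_Cauchy convergentI)
  have "Cauchy n"
  proof (rule metric_CauchyI)
    fix \<epsilon> :: real assume "\<epsilon> > 0"
    then obtain N where N: "\<And>k l. k \<ge> N \<Longrightarrow> l \<ge> N \<Longrightarrow> dist (A (n k)) (A (n l)) < c * \<epsilon>"
      using \<open>Cauchy (\<lambda>k. A (n k))\<close> c(1) unfolding Cauchy_def by (metis mult_pos_pos)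
    have "dist (n k) (n l) < \<epsilon>" if "k \<ge> N" "l \<ge> N" for k l
    proof -
      have "c * dist (n k) (n l) \<le> dist (A (n k)) (A (n l))"
        using c(2)[OF n[of k l]] by (simp add: dist_norm lin)
      with N[OF that] have "c * dist (n k) (n l) < c * \<epsilon>" by simp
      then show ?thesis using c(1) by simp
    qed
    then show "\<exists>N. \<forall>k\<ge>N. \<forall>l\<ge>N. dist (n k) (n l) < \<epsilon>" by blast
  qed
  then obtain m where m: "n \<longlonglongrightarrow> m" using Cauchy_convergent convergentD by blast
  define y where "y = m + t *\<^sub>C h"
  have "(\<lambda>k. n k + a k *\<^sub>C h) \<longlonglongrightarrow> y"
    unfolding y_def by (intro tendsto_add m scaleC.tendsto a tendsto_const)
  then have y: "(\<lambda>k. x (r k)) \<longlonglongrightarrow> y" by (simp add: n_def)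
  have "norm y = 1"
    using tendsto_norm[OF y] x(2) by (simp add: LIMSEQ_const_iff)
  moreover have "A y = 0"
    using LIMSEQ_unique[OF bounded_linear.tendsto[OF bounded_clinearD(1)[OF A] y] Axr] .
  moreover have "cinner y f = 0" if "f \<in> E" for f
  proof -
    have "(\<lambda>k. cinner (x (r k)) f) \<longlonglongrightarrow> cinner y f" by (intro cinner.tendsto y tendsto_const)
    then show ?thesis using x(1) that by (simp add: ortho_def LIMSEQ_const_iff)
  qed
  then have "y \<in> ortho E" by (simp add: ortho_def)
  ultimately show False using inj[of y] by auto
qed

lemma bounded_below_of_cofinite:
  fixes A :: "'a::complex_hilbert_space \<Rightarrow> 'a"
  assumes A: "bounded_clinear A" and "finite E" "bounded_below_on (ortho E) A"
    and inj: "\<And>x. A x = 0 \<Longrightarrow> x = 0"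
  shows "bounded_below_on UNIV A"
  using assms(2,3)
proof (induction E)
  case empty
  then show ?case by (simp add: ortho_def)
next
  case (insert e E)
  then show ?case using bounded_below_extend[OF A _ inj] by blast
qed

text \<open>
  The sequence is chosen recursively: the next vector is an approximate null vector orthogonal to
  all the previous ones.
\<close>

lemma weyl_sequence:
  fixes A :: "'a::complex_inner \<Rightarrow> 'a"
  assumes A: "bounded_clinear A" and nb: "\<And>E. finite E \<Longrightarrow> \<not> bounded_below_on (ortho E) A"
  obtains x where "orthonormal_seq x" "(\<lambda>k. A (x k)) \<longlonglongrightarrow> 0"
proof -
  have "\<exists>x. \<forall>k. norm (x k) = 1 \<and> (\<forall>i<k. cinner (x k) (x i) = 0) \<and> norm (A (x k)) < 1 / real (Suc k)"
  proof (rule dependent_wellorder_choice)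
    fix k :: nat and f :: "nat \<Rightarrow> 'a"
    have "\<exists>x\<in>ortho (f ` {..<k}). norm x = 1 \<and> norm (A x) < 1 / real (Suc k)"
      by (intro not_bounded_below_on_unit[OF A csubspace_ortho nb]) auto
    then show "\<exists>y. norm y = 1 \<and> (\<forall>i<k. cinner y (f i) = 0) \<and> norm (A y) < 1 / real (Suc k)"
      by (auto simp: ortho_def)
  qed auto
  then obtain x where x: "\<And>k. norm (x k) = 1" "\<And>k i. i < k \<Longrightarrow> cinner (x k) (x i) = 0"
    "\<And>k. norm (A (x k)) < 1 / real (Suc k)" by blast
  have "cinner (x k) (x l) = (if k = l then 1 else 0)" for k l
    using x(1)[of k] x(2)[of k l] x(2)[of l k] cinner_commute[of "x k" "x l"]
    by (cases k l rule: linorder_cases) (auto simp: cinner_self)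
  then have "orthonormal_seq x" by (simp add: orthonormal_seq_def)
  moreover have "(\<lambda>k. A (x k)) \<longlonglongrightarrow> 0"
    by (rule LIMSEQ_norm_0) (use x(3) in auto)
  ultimately show thesis by (rule that)
qed

section \<open>Supporting half-spaces of the Harte spectrum\<close>

text \<open>
  \<open>B x = y\<close> means \<open>x = inv A (y - (B x - A x))\<close>, and the right-hand side is a contraction in \<open>x\<close>
  with constant \<open>d / c\<close>.
\<close>

lemma surj_perturbation:
  fixes A B :: "'a::banach \<Rightarrow> 'a"
  assumes A: "linear A" "surj A" "\<And>x. c * norm x \<le> norm (A x)" and B: "linear B"
    "\<And>x. norm (B x - A x) \<le> d * norm x" and cd: "0 \<le> d" "d < c"
  shows "surj B"
proof -
  have inj: "inj A"
  proof (rule linear_injective_0[OF A(1), THEN iffD2], intro allI impI)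
    fix x assume "A x = 0"
    then have "c * norm x \<le> 0" using A(3)[of x] by simp
    then show "x = 0" using cd by (simp add: mult_le_0_iff)
  qed
  define R where "R = inv A"
  have AR: "A (R y) = y" for y unfolding R_def using A(2) by (simp add: surj_f_inv_f)
  show ?thesis
    unfolding surj_def
  proof
    fix y
    define f where "f x = R (y - (B x - A x))" for x
    have "dist (f u) (f v) \<le> (d / c) * dist u v" for u v
    proof -
      have "c * dist (f u) (f v) \<le> norm (A (f u) - A (f v))"
        using A(3)[of "f u - f v"] by (simp add: dist_norm linear_diff[OF A(1)])
      also have "A (f u) - A (f v) = (B v - A v) - (B u - A u)"
        by (simp add: f_def AR)
      also have "\<dots> = B (v - u) - A (v - u)"
        by (simp add: linear_diff[OF A(1)] linear_diff[OF B(1)])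
      also have "norm \<dots> \<le> d * dist u v"
        using B(2)[of "v - u"] by (simp add: dist_norm norm_minus_commute)
      finally show ?thesis using cd by (simp add: field_simps)
    qed
    then obtain x where "f x = x"
      using banach_fix_type[of "d / c" f] cd by (auto simp: divide_simps)
    then have "A x = y - (B x - A x)" using AR by (metis f_def)
    then show "\<exists>x. y = B x" by (intro exI[of _ x]) simp
  qed
qed

text \<open>
  Along the ray surjectivity of \<open>S - (z + t)\<close> is an open and closed condition on \<open>t\<close> by
  \<open>surj_perturbation\<close>, and it holds for large \<open>t\<close>, when \<open>S\<close> is a small perturbation of a multiple of
  the identity.  Connectedness of the ray brings it back to its origin.
\<close>

lemma surj_on_ray:
  fixes S :: "'a::complex_hilbert_space \<Rightarrow> 'a"
  assumes S: "bounded_clinear S"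
    and bb: "\<And>t. t \<ge> (0::real) \<Longrightarrow> bounded_below_on UNIV (\<lambda>x. S x - (z + of_real t) *\<^sub>C x)"
  shows "surj (\<lambda>x. S x - z *\<^sub>C x)"
proof -
  define A where "A t = (\<lambda>x. S x - (z + complex_of_real t) *\<^sub>C x)" for t
  have lin: "linear (A t)" for t
    unfolding A_def using S bounded_clinear_diff[OF S bounded_clinear_scaleC]
    by (simp add: bounded_clinear_def bounded_linear.linear)
  have AA: "A s x - A t x = complex_of_real (t - s) *\<^sub>C x" for s t x
    by (simp add: A_def scaleC_add_left scaleC.diff_left algebra_simps)
  have step: "surj (A s)" if "surj (A t)" "\<And>x. c * norm x \<le> norm (A t x)" "\<bar>s - t\<bar> < c" for s t c
  proof (rule surj_perturbation[OF lin that(1,2) lin])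
    show "norm (A s x - A t x) \<le> \<bar>s - t\<bar> * norm x" for x
      by (simp add: AA norm_scaleC abs_minus_commute del: of_real_diff)
  qed (use that in auto)
  define U where "U = {t. t \<ge> 0 \<and> surj (A t)}"
  have loc: "\<exists>\<delta>>0. \<forall>s\<ge>0. \<bar>s - t\<bar> < \<delta> \<longrightarrow> (s \<in> U \<longleftrightarrow> t \<in> U)" if t: "t \<ge> 0" for t
  proof -
    obtain c where c: "c > 0" "\<And>x. c * norm x \<le> norm (A t x)"
      using bb[OF t] by (auto simp: bounded_below_on_def A_def)
    have "s \<in> U \<longleftrightarrow> t \<in> U" if s: "s \<ge> 0" "\<bar>s - t\<bar> < c / 2" for s
    proof
      assume "t \<in> U"
      then show "s \<in> U" using step[of t c s] c s by (auto simp: U_def)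
    next
      assume "s \<in> U"
      \<comment> \<open>The lower bound at \<open>t\<close> survives, halved, at \<open>s\<close>, so surjectivity passes back from \<open>s\<close> to \<open>t\<close>.\<close>
      have "c / 2 * norm x \<le> norm (A s x)" for x
      proof -
        have "norm (A t x) \<le> norm (A s x) + norm (A t x - A s x)"
          by (metis norm_triangle_sub)
        also have "norm (A t x - A s x) \<le> c / 2 * norm x"
          unfolding AA norm_scaleC norm_of_real using s by (intro mult_right_mono) auto
        finally show ?thesis using c(2)[of x] by (simp add: field_simps)
      qed
      moreover have "\<bar>t - s\<bar> < c / 2" using s(2) by (simp add: abs_minus_commute)
      ultimately have "surj (A t)" using \<open>s \<in> U\<close> by (intro step[of s "c / 2" t]) (auto simp: U_def)
      then show "t \<in> U" using t by (simp add: U_def)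
    qed
    then show ?thesis using c(1) by (intro exI[of _ "c / 2"]) auto
  qed
  have "openin (top_of_set {0..}) U"
    unfolding openin_euclidean_subtopology_iff
  proof (intro conjI ballI)
    show "\<exists>\<delta>>0. \<forall>s\<in>{0..}. dist s t < \<delta> \<longrightarrow> s \<in> U" if "t \<in> U" for t
      using that loc[of t] by (auto simp: U_def dist_real_def)
  qed (auto simp: U_def)
  moreover have "openin (top_of_set {0..}) ({0..} - U)"
    unfolding openin_euclidean_subtopology_iff
  proof (intro conjI ballI)
    show "\<exists>\<delta>>0. \<forall>s\<in>{0..}. dist s t < \<delta> \<longrightarrow> s \<in> {0..} - U" if t: "t \<in> {0..} - U" for t
    proof -
      obtain \<delta> where \<delta>: "\<delta> > 0" "\<And>s. s \<ge> 0 \<Longrightarrow> \<bar>s - t\<bar> < \<delta> \<Longrightarrow> s \<in> U \<longleftrightarrow> t \<in> U"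
        using loc[of t] t by auto
      have "s \<in> {0..} - U" if "s \<in> {0..}" "dist s t < \<delta>" for s
        using \<delta>(2)[of s] that t by (simp add: dist_real_def)
      with \<delta>(1) show ?thesis by blast
    qed
  qed auto
  then have "closedin (top_of_set {0..}) U"
    by (auto simp: closedin_def U_def)
  moreover have "connected {0::real..}" by simp
  ultimately have "U = {} \<or> U = {0..}" using connected_clopen[of "{0::real..}"] by blast
  moreover have "U \<noteq> {}"
  proof -
    obtain K where K: "K > 0" "\<And>x. norm (S x) \<le> norm x * K"
      using bounded_linear.pos_bounded[OF bounded_clinearD(1)[OF S]] by auto
    \<comment> \<open>\<open>K\<close> bounds \<open>S\<close>, so \<open>\<bar>z + t\<bar> \<ge> K + 1\<close> makes \<open>S\<close> a perturbation of \<open>- (z + t)\<close> that is small enough.\<close>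
    define t where "t = K + 1 + cmod z"
    define w where "w = z + complex_of_real t"
    have t: "t \<ge> 0" using K by (simp add: t_def)
    have "cmod (complex_of_real t) = t" using t by simp
    then have w: "cmod w \<ge> K + 1"
      using norm_diff_ineq[of "complex_of_real t" z] unfolding w_def t_def by (simp only: add.commute[of z])
    have surjw: "surj (\<lambda>x. - w *\<^sub>C x :: 'a)"
      unfolding surj_def
    proof
      fix y :: 'a
      show "\<exists>x. y = - w *\<^sub>C x"
        using w K by (intro exI[of _ "(- 1 / w) *\<^sub>C y"]) (auto simp: scaleC_scaleC)
    qed
    have linw: "linear (\<lambda>x. - w *\<^sub>C x :: 'a)"
      by (rule bounded_linear.linear[OF scaleC.bounded_linear_right])
    have "surj (A t)"
    proof (rule surj_perturbation[OF linw surjw _ lin])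
      show "(K + 1) * norm x \<le> norm (- w *\<^sub>C x)" for x :: 'a
        unfolding norm_scaleC using mult_right_mono[OF w, of "norm x"] by simp
      show "norm (A t x - - w *\<^sub>C x) \<le> K * norm x" for x
        using K(2)[of x] by (simp add: A_def w_def[symmetric] scaleC.minus_left mult.commute)
    qed (use K(1) in auto)
    then show ?thesis using t by (auto simp: U_def)
  qed
  ultimately have "0 \<in> U" by auto
  then show ?thesis by (simp add: U_def A_def)
qed

text \<open>
  Let \<open>S = (\<Sum>j. a j *\<^sub>C T j)\<close> and \<open>z = (\<Sum>j. a j * \<nu> $ j)\<close>.  An inverse \<open>R\<close> of \<open>S - z\<close> would yield
  \<open>(\<Sum>j. (a j *\<^sub>C R) (T j - \<nu> $ j)) = I = (\<Sum>j. (T j - \<nu> $ j) (a j *\<^sub>C R))\<close>, contradicting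
  \<open>\<nu> \<in> harte_spectrum T\<close>.  So \<open>S - z\<close> is not invertible, and lower bounds all along the ray
  \<open>z + t\<close> are impossible by \<open>surj_on_ray\<close>.
\<close>

lemma harte_spectrum_ray:
  fixes T :: "'n::finite \<Rightarrow> 'a::complex_hilbert_space \<Rightarrow> 'a"
  assumes T: "\<And>j. bounded_clinear (T j)" and l: "\<nu> \<in> harte_spectrum T"
  shows "\<exists>t\<ge>0::real. \<not> bounded_below_on UNIV
    (\<lambda>x. (\<Sum>j\<in>UNIV. a j *\<^sub>C T j x) - ((\<Sum>j\<in>UNIV. a j * \<nu> $ j) + of_real t) *\<^sub>C x)"
proof (rule ccontr)
  define S where "S x = (\<Sum>j\<in>UNIV. a j *\<^sub>C T j x)" for x
  define z where "z = (\<Sum>j\<in>UNIV. a j * \<nu> $ j)"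
  define A where "A x = S x - z *\<^sub>C x" for x
  assume "\<not> ?thesis"
  then have bb: "bounded_below_on UNIV (\<lambda>x. S x - (z + of_real t) *\<^sub>C x)" if "t \<ge> 0" for t :: real
    using that by (auto simp: S_def z_def)
  have S: "bounded_clinear S"
    unfolding S_def by (intro bounded_clinear_sum bounded_clinear_compose[OF bounded_clinear_scaleC] T)
  have A: "bounded_clinear A"
    unfolding A_def by (intro bounded_clinear_diff S bounded_clinear_scaleC)
  note linA = linear_simps[OF bounded_clinearD(1)[OF A]] bounded_clinearD(2)[OF A]
  have sA: "surj A" unfolding A_def by (rule surj_on_ray[OF S bb])
  obtain c where c: "c > 0" "\<And>x. c * norm x \<le> norm (A x)"
    using bb[of 0] by (auto simp: bounded_below_on_def A_def)
  have inj: "x = y" if "A x = A y" for x y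
    using c(2)[of "x - y"] c(1) that by (simp add: linA mult_le_0_iff)
  define R where "R = inv A"
  have AR: "A (R y) = y" for y unfolding R_def using sA by (simp add: surj_f_inv_f)
  have RA: "R (A x) = x" for x by (rule inj) (simp add: AR)
  have R: "bounded_clinear R"
    unfolding bounded_clinear_def
  proof
    show "bounded_linear R"
    proof (rule bounded_linear_intro[where K = "1 / c"])
      show "norm (R x) \<le> norm x * (1 / c)" for x
        using c(2)[of "R x"] c(1) by (simp add: AR field_simps)
      show "R (x + y) = R x + R y" for x y by (rule inj) (simp add: AR linA)
      show "R (r *\<^sub>R x) = r *\<^sub>R R x" for r x by (rule inj) (simp add: AR linA)
    qed
    show "\<forall>b x. R (b *\<^sub>C x) = b *\<^sub>C R x"
      by (intro allI, rule inj) (simp add: AR linA)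
  qed
  have sumA: "(\<Sum>j\<in>UNIV. a j *\<^sub>C (T j x - \<nu> $ j *\<^sub>C x)) = A x" for x
    unfolding A_def S_def z_def scaleC.diff_right sum_subtractf scaleC_scaleC scaleC.sum_left ..
  define L where "L j = (\<lambda>x. a j *\<^sub>C R x)" for j
  have L: "bounded_clinear (L j)" for j
    unfolding L_def by (rule bounded_clinear_compose[OF bounded_clinear_scaleC R])
  have "(\<Sum>j\<in>UNIV. L j (T j x - \<nu> $ j *\<^sub>C x)) = x" for x
  proof -
    have "(\<Sum>j\<in>UNIV. L j (T j x - \<nu> $ j *\<^sub>C x)) = R (\<Sum>j\<in>UNIV. a j *\<^sub>C (T j x - \<nu> $ j *\<^sub>C x))"
      by (simp only: L_def bounded_clinear_lincomb[OF R])
    then show ?thesis by (simp only: sumA RA)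
  qed
  moreover have "(\<Sum>j\<in>UNIV. T j (L j x) - \<nu> $ j *\<^sub>C L j x) = x" for x
  proof -
    have "(\<Sum>j\<in>UNIV. T j (L j x) - \<nu> $ j *\<^sub>C L j x) = (\<Sum>j\<in>UNIV. a j *\<^sub>C (T j (R x) - \<nu> $ j *\<^sub>C R x))"
      by (simp add: L_def bounded_clinearD(2)[OF T] scaleC.diff_right scaleC_scaleC mult.commute)
    then show ?thesis by (simp only: sumA AR)
  qed
  ultimately have "\<nu> \<notin> harte_spectrum T"
    using L unfolding harte_spectrum_def Compl_iff mem_Collect_eq not_not
    by (intro exI[of _ L] conjI allI)
  then show False using l by simp
qed

text \<open>
  Let \<open>m\<close> be a point on the ray of \<open>harte_spectrum_ray\<close> where \<open>S - m\<close> fails to be bounded below.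
  If \<open>S - m\<close> has an orthonormal sequence of approximate null vectors, every limit point \<open>\<kappa>\<close> of the
  values of the tuple along it is an essential numerical value with \<open>(\<Sum>j. a j * \<kappa> $ j) = m\<close>.  Otherwise
  the kernel of \<open>S - m\<close> is nonzero and finite-dimensional; it is invariant under the commuting
  tuple, so it contains a joint eigenvector, again with \<open>(\<Sum>j. a j * \<kappa> $ j) = m\<close>.
\<close>

lemma harte_spectrum_support:
  fixes T :: "'n::finite \<Rightarrow> 'a::complex_hilbert_space \<Rightarrow> 'a"
  assumes T: "\<And>j. bounded_clinear (T j)" and comm: "commuting_tuple T"
    and l: "\<nu> \<in> harte_spectrum T"
  shows "\<exists>\<kappa>\<in>joint_essential_numerical_range T \<union> joint_point_spectrum T.
    Re (\<Sum>j\<in>UNIV. a j * \<nu> $ j) \<le> Re (\<Sum>j\<in>UNIV. a j * \<kappa> $ j)"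
proof -
  define S where "S x = (\<Sum>j\<in>UNIV. a j *\<^sub>C T j x)" for x
  define z where "z = (\<Sum>j\<in>UNIV. a j * \<nu> $ j)"
  obtain t where t: "t \<ge> 0" "\<not> bounded_below_on UNIV (\<lambda>x. S x - (z + of_real t) *\<^sub>C x)"
    using harte_spectrum_ray[OF T l, of a] by (auto simp: S_def z_def)
  define m where "m = z + of_real t"
  define A where "A x = S x - m *\<^sub>C x" for x
  have nb: "\<not> bounded_below_on UNIV A" using t(2) unfolding A_def[abs_def] m_def .
  have S: "bounded_clinear S"
    unfolding S_def by (intro bounded_clinear_sum bounded_clinear_compose[OF bounded_clinear_scaleC] T)
  have A: "bounded_clinear A"
    unfolding A_def by (intro bounded_clinear_diff S bounded_clinear_scaleC)
  note linA = linear_simps[OF bounded_clinearD(1)[OF A]] bounded_clinearD(2)[OF A]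
  have "\<exists>\<kappa>\<in>joint_essential_numerical_range T \<union> joint_point_spectrum T. (\<Sum>j\<in>UNIV. a j * \<kappa> $ j) = m"
  proof (cases "\<exists>E. finite E \<and> bounded_below_on (ortho E) A")
    case False
    then obtain x where x: "orthonormal_seq x" "(\<lambda>k. A (x k)) \<longlonglongrightarrow> 0"
      using weyl_sequence[OF A] by blast
    have nx: "norm (x k) = 1" for k by (rule orthonormal_norm[OF x(1)])
    have "bounded (range (\<lambda>k. form_value T (x k)))"
    proof -
      have "\<exists>K. \<forall>y. norm (T j y) \<le> norm y * K" for j
        using bounded_linear.bounded[OF bounded_clinearD(1)[OF T]] .
      then obtain K where K: "\<And>j y. norm (T j y) \<le> norm y * K j" by metis
      have "norm (form_value T (x k)) \<le> (\<Sum>j\<in>UNIV. K j)" for k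
      proof -
        have "norm (form_value T (x k)) \<le> (\<Sum>j\<in>UNIV. cmod (form_value T (x k) $ j))"
          by (simp add: norm_vec_def L2_set_le_sum)
        also have "\<dots> \<le> (\<Sum>j\<in>UNIV. K j)"
        proof (rule sum_mono)
          fix j
          have "cmod (form_value T (x k) $ j) \<le> norm (T j (x k)) * norm (x k)"
            by (simp add: form_value_def cmod_cinner_le)
          also have "\<dots> \<le> K j" using K[of j "x k"] nx by simp
          finally show "cmod (form_value T (x k) $ j) \<le> K j" .
        qed
        finally show ?thesis .
      qed
      then show ?thesis by (intro boundedI[of _ "\<Sum>j\<in>UNIV. K j"]) auto
    qed
    then obtain \<kappa> r where r: "strict_mono r" "((\<lambda>k. form_value T (x k)) \<circ> r) \<longlonglongrightarrow> \<kappa>"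
      using bounded_imp_convergent_subsequence by blast
    have k: "(\<lambda>k. cinner (T j (x (r k))) (x (r k))) \<longlonglongrightarrow> \<kappa> $ j" for j
      using tendsto_vec_nth[OF r(2), of j] by (simp add: form_value_def comp_def)
    have "orthonormal_seq (\<lambda>k. x (r k))"
      using x(1) strict_mono_eq[OF r(1)] by (simp add: orthonormal_seq_def)
    then have ess: "\<kappa> \<in> joint_essential_numerical_range T"
      using k by (auto simp: joint_essential_numerical_range_def)
    have "(\<lambda>k. \<Sum>j\<in>UNIV. a j * cinner (T j (x (r k))) (x (r k))) \<longlonglongrightarrow> (\<Sum>j\<in>UNIV. a j * \<kappa> $ j)"
      by (intro tendsto_intros k)
    moreover have "(\<Sum>j\<in>UNIV. a j * cinner (T j (x (r k))) (x (r k))) = cinner (A (x (r k))) (x (r k)) + m" for k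
      by (simp add: A_def S_def cinner.diff_left cinner.sum_left cinner_scaleC_left cinner_self nx)
    moreover have "(\<lambda>k. cinner (A (x (r k))) (x (r k)) + m) \<longlonglongrightarrow> 0 + m"
    proof (intro tendsto_add tendsto_const)
      have "(\<lambda>k. norm (A (x (r k)))) \<longlonglongrightarrow> 0"
        using LIMSEQ_subseq_LIMSEQ[OF tendsto_norm_zero[OF x(2)] r(1)] by (simp add: comp_def)
      then show "(\<lambda>k. cinner (A (x (r k))) (x (r k))) \<longlonglongrightarrow> 0"
        by (rule Lim_null_comparison[rotated])
          (use cmod_cinner_le[of "A (x (r _))" "x (r _)"] nx in auto)
    qed
    ultimately have "(\<Sum>j\<in>UNIV. a j * \<kappa> $ j) = m" using LIMSEQ_unique by fastforce
    then show ?thesis using ess by blast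
  next
    case True
    then obtain E where E: "finite E" "bounded_below_on (ortho E) A" by blast
    define V where "V = {x. A x = 0}"
    have V0: "V \<noteq> {0}" using bounded_below_of_cofinite[OF A E] nb by (auto simp: V_def)
    have cV: "csubspace V"
      by (auto simp: V_def csubspace_def linA scaleC.zero_right)
    have VE: "V \<inter> ortho E = {0}"
      using E(2) csubspace_ortho[of E] cV by (auto simp: V_def bounded_below_on_def csubspace_def mult_le_0_iff)
    have c: "T i (T j x) = T j (T i x)" for i j x
      using comm by (auto simp: commuting_tuple_def fun_eq_iff)
    have "A (T j x) = T j (A x)" for j x
    proof -
      have "T j (S x) = S (T j x)"
        unfolding S_def bounded_clinear_lincomb[OF T] by (subst c) (rule refl)
      then show ?thesis
        unfolding A_def using linear_simps[OF bounded_clinearD(1)[OF T]] by (simp add: bounded_clinearD(2)[OF T])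
    qed
    moreover have "T j 0 = 0" for j using linear_simps[OF bounded_clinearD(1)[OF T]] by simp
    ultimately have TV: "T j x \<in> V" if "x \<in> V" for j x
      using that by (simp add: V_def)
    obtain x k where x: "x \<in> V" "x \<noteq> 0" "\<And>j. T j x = k j *\<^sub>C x"
      using joint_eigenvector_exists[where T = T and J = UNIV, OF T c E(1) finite_class.finite_UNIV cV TV VE V0]
      by auto
    define \<kappa> where "\<kappa> = (\<chi> j. k j)"
    have "x \<in> (\<Inter>j. {x. T j x - \<kappa> $ j *\<^sub>C x = 0})" by (simp add: x(3) \<kappa>_def)
    then have "(\<Inter>j. {x. T j x - \<kappa> $ j *\<^sub>C x = 0}) \<noteq> {0}" using x(2) by (metis singletonD)
    then have ps: "\<kappa> \<in> joint_point_spectrum T" by (simp add: joint_point_spectrum_def)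
    have "A x = ((\<Sum>j\<in>UNIV. a j * \<kappa> $ j) - m) *\<^sub>C x"
      by (simp add: A_def S_def x(3) \<kappa>_def scaleC_scaleC scaleC.sum_left scaleC.diff_left)
    then have "(\<Sum>j\<in>UNIV. a j * \<kappa> $ j) = m" using x(1,2) by (simp add: V_def)
    then show ?thesis using ps by blast
  qed
  then obtain \<kappa> where k: "\<kappa> \<in> joint_essential_numerical_range T \<union> joint_point_spectrum T"
    "(\<Sum>j\<in>UNIV. a j * \<kappa> $ j) = m" by blast
  have "Re z \<le> Re m" using t(1) by (simp add: m_def)
  then show ?thesis by (intro bexI[OF _ k(1)]) (simp only: k(2) z_def)
qed

lemma harte_spectrum_subset_closure_hull:
  fixes T :: "'n::finite \<Rightarrow> 'a::complex_hilbert_space \<Rightarrow> 'a"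
  assumes T: "\<And>j. bounded_clinear (T j)" and comm: "commuting_tuple T"
  shows "harte_spectrum T \<subseteq> closure (convex hull (joint_essential_numerical_range T \<union> joint_point_spectrum T))"
    (is "_ \<subseteq> closure (convex hull ?K)")
proof (rule subsetI, rule ccontr)
  fix \<nu> assume l: "\<nu> \<in> harte_spectrum T" and "\<nu> \<notin> closure (convex hull ?K)"
  then obtain b d where b: "inner b \<nu> < d" "\<And>x. x \<in> closure (convex hull ?K) \<Longrightarrow> inner b x > d"
    using separating_hyperplane_closed_point[of "closure (convex hull ?K)" \<nu>]
    by (metis closed_closure convex_closure convex_convex_hull)
  \<comment> \<open>Minus \<open>inner b\<close> is the real part of the complex linear form with coefficients \<open>- cnj (b $ j)\<close>.\<close>
  have inner: "inner b x = - Re (\<Sum>j\<in>UNIV. - cnj (b $ j) * x $ j)" for x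
    by (simp add: inner_vec_def inner_complex_def sum_negf)
  obtain \<kappa> where k: "\<kappa> \<in> ?K"
    "Re (\<Sum>j\<in>UNIV. - cnj (b $ j) * \<nu> $ j) \<le> Re (\<Sum>j\<in>UNIV. - cnj (b $ j) * \<kappa> $ j)"
    using harte_spectrum_support[OF T comm l, of "\<lambda>j. - cnj (b $ j)"] by (elim bexE)
  have "\<kappa> \<in> closure (convex hull ?K)" using k(1) by (meson closure_subset hull_inc subsetD)
  then have "d < inner b \<kappa>" by (rule b(2))
  with b(1) k(2) show False by (simp only: inner)
qed

theorem theorem1p1:
  fixes T :: "'n::finite \<Rightarrow> 'a::complex_hilbert_space \<Rightarrow> 'a"
  assumes "\<And>j. bounded_clinear (T j)"
  shows "interior (convex hull (joint_essential_numerical_range T \<union> joint_point_spectrum T))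
           \<subseteq> joint_numerical_range T
       \<and> (commuting_tuple T \<longrightarrow>
           interior (convex hull (harte_spectrum T)) \<subseteq> joint_numerical_range T)"
proof (intro conjI impI)
  let ?K = "convex hull (joint_essential_numerical_range T \<union> joint_point_spectrum T)"
  show K: "interior ?K \<subseteq> joint_numerical_range T"
    by (rule interior_hull_subset_numerical_range[OF assms])
  assume comm: "commuting_tuple T"
  have "convex hull (harte_spectrum T) \<subseteq> closure ?K"
    by (intro hull_minimal harte_spectrum_subset_closure_hull[OF assms comm] convex_closure convex_convex_hull)
  then have "interior (convex hull (harte_spectrum T)) \<subseteq> interior (closure ?K)"
    by (rule interior_mono)
  also have "\<dots> = interior ?K" by (rule convex_interior_closure[OF convex_convex_hull])
  finally show "interior (convex hull (harte_spectrum T)) \<subseteq> joint_numerical_range T" using K by simp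
qed

end
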